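(* Let $P(\tau)=\theta\begin{bmatrix}1/5\\1/5\end{bmatrix}(0,\tau)\,\theta\begin{bmatrix}1/5\\9/5\end{bmatrix}(0,\tau)$. For every $M=\begin{pmatrix} a&b\\ c&d\end{pmatrix}\in\Gamma_{\theta,5}$ and $\tau\in\mathscr{H}$, $P(M\tau)=\nu(M)(c\tau+d)P(\tau)$ with $\nu(M)=\nu_\eta^6(M)\exp\!\left(\frac{\pi i}{5}E\right)$, where $E=-\frac{4b}{5}-\frac{8ab}{5}-\frac{8cd}{5}$ if $M\equiv\begin{pmatrix}1&0\\0&1\end{pmatrix}\pmod 5$; $E=-\frac{6b}{5}-\frac{8ab}{5}-\frac{8cd}{5}$ if $M\equiv\begin{pmatrix}-1&0\\0&-1\end{pmatrix}\pmod 5$; $E=-5-\frac{4d}{5}-\frac{8ab}{5}-\frac{8cd}{5}$ if $M\equiv\begin{pmatrix}0&-1\\1&0\end{pmatrix}\pmod 5$; $E=-5+\frac{4d}{5}-\frac{8ab}{5}-\frac{8cd}{5}$ if $M\equiv\begin{pmatrix}0&1\\-1&0\end{pmatrix}\pmod 5$.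
   Context: $\mathscr{H}$ is the upper half plane, $M\tau=\frac{a\tau+b}{c\tau+d}$. $\theta\begin{bmatrix}\epsilon\\ \epsilon'\end{bmatrix}(v,\tau)=\sum_{n\in\mathbb{Z}}\exp\!\Big(2\pi i\Big[\tfrac12\big(n+\tfrac{\epsilon}{2}\big)^2\tau+\big(n+\tfrac{\epsilon}{2}\big)\big(v+\tfrac{\epsilon'}{2}\big)\Big]\Big)$. $\Gamma_{\theta,5}=\{M\in SL(2,\mathbb{Z}): M\equiv\pm\begin{pmatrix}1&0\\0&1\end{pmatrix}\text{ or }\pm\begin{pmatrix}0&-1\\1&0\end{pmatrix}\pmod 5\}$. $\eta(\tau)=q^{1/24}\prod_{n\ge1}(1-q^n)$, $q=e^{2\pi i\tau}$; $\nu_\eta$ is its multiplier system, $\eta(M\tau)=\nu_\eta(M)(c\tau+d)^{1/2}\eta(\tau)$ with branch $-\pi\le\arg(c\tau+d)<\pi$; explicitly $\nu_\eta(M)=\left(\frac{d}{c}\right)^{*}\exp\{\frac{\pi i}{12}[(a+d)c-bd(c^2-1)-3c]\}$ if $c$ odd, $\nu_\eta(M)=\left(\frac{c}{d}\right)_{*}\exp\{\frac{\pi i}{12}[(a+d)c-bd(c^2-1)+3d-3-3cd]\}$ if $c$ even, with $\left(\frac{c}{d}\right)^{*}=\left(\frac{c}{|d|}\right)$, $\left(\frac{c}{d}\right)_{*}=\left(\frac{c}{|d|}\right)(-1)^{\frac{\operatorname{sign}c-1}{2}\frac{\operatorname{sign}d-1}{2}}$ (Jacobi symbols). *)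

theory Defs
  imports "HOL-Analysis.Analysis" "HOL-Number_Theory.Number_Theory"
begin

definition theta_char :: "real \<Rightarrow> real \<Rightarrow> complex \<Rightarrow> complex \<Rightarrow> complex" where
  "theta_char eps eps' v \<tau> =
     (\<Sum>\<^sub>\<infinity> n::int. exp (2 * pi * \<i> *
        ((1/2) * (of_int n + of_real eps / 2)^2 * \<tau>
         + (of_int n + of_real eps / 2) * (v + of_real eps' / 2))))"

definition jacobi :: "int \<Rightarrow> int \<Rightarrow> int" where
  "jacobi a n = (\<Prod>p\<in>prime_factors n. Legendre a p ^ multiplicity p n)"

definition jacobi_upper :: "int \<Rightarrow> int \<Rightarrow> int" where
  "jacobi_upper c d = jacobi c \<bar>d\<bar>"

(* (c/d)_* = (c/|d|) (-1)^{(sign c - 1)/2 (sign d - 1)/2};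
   the sign factor is -1 iff both c and d are negative (convention for c = 0:
   sign 0 counted as negative, which is the convention making the formula the
   multiplier of eta at M = -I) *)
definition jacobi_lower :: "int \<Rightarrow> int \<Rightarrow> int" where
  "jacobi_lower c d = jacobi c \<bar>d\<bar> * (if c \<le> 0 \<and> d < 0 then -1 else 1)"

(* the multiplier system of the Dedekind eta function, M = (a b; c d) *)
definition nu_eta :: "int \<Rightarrow> int \<Rightarrow> int \<Rightarrow> int \<Rightarrow> complex" where
  "nu_eta a b c d =
     (if odd c then
        of_int (jacobi_upper d c) *
        exp (pi * \<i> / 12 * of_int ((a + d) * c - b * d * (c^2 - 1) - 3 * c))
      else
        of_int (jacobi_lower c d) *
        exp (pi * \<i> / 12 * of_int ((a + d) * c - b * d * (c^2 - 1) + 3 * d - 3 - 3 * c * d)))"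

definition moebius :: "int \<Rightarrow> int \<Rightarrow> int \<Rightarrow> int \<Rightarrow> complex \<Rightarrow> complex" where
  "moebius a b c d \<tau> = (of_int a * \<tau> + of_int b) / (of_int c * \<tau> + of_int d)"

definition cong_mat5 :: "int \<Rightarrow> int \<Rightarrow> int \<Rightarrow> int \<Rightarrow> int \<Rightarrow> int \<Rightarrow> int \<Rightarrow> int \<Rightarrow> bool" where
  "cong_mat5 a b c d a' b' c' d' \<longleftrightarrow>
     [a = a'] (mod 5) \<and> [b = b'] (mod 5) \<and> [c = c'] (mod 5) \<and> [d = d'] (mod 5)"

definition Gamma_theta5 :: "int \<Rightarrow> int \<Rightarrow> int \<Rightarrow> int \<Rightarrow> bool" where
  "Gamma_theta5 a b c d \<longleftrightarrow> a * d - b * c = 1 \<and>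
     (cong_mat5 a b c d 1 0 0 1 \<or> cong_mat5 a b c d (-1) 0 0 (-1) \<or>
      cong_mat5 a b c d 0 (-1) 1 0 \<or> cong_mat5 a b c d 0 1 (-1) 0)"

definition P_theta :: "complex \<Rightarrow> complex" where
  "P_theta \<tau> = theta_char (1/5) (1/5) 0 \<tau> * theta_char (1/5) (9/5) 0 \<tau>"

definition E_exp :: "int \<Rightarrow> int \<Rightarrow> int \<Rightarrow> int \<Rightarrow> real" where
  "E_exp a b c d =
     (if cong_mat5 a b c d 1 0 0 1 then - 4 * real_of_int b / 5 - 8 * real_of_int a * real_of_int b / 5 - 8 * real_of_int c * real_of_int d / 5
      else if cong_mat5 a b c d (-1) 0 0 (-1) then - 6 * real_of_int b / 5 - 8 * real_of_int a * real_of_int b / 5 - 8 * real_of_int c * real_of_int d / 5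
      else if cong_mat5 a b c d 0 (-1) 1 0 then - 5 - 4 * real_of_int d / 5 - 8 * real_of_int a * real_of_int b / 5 - 8 * real_of_int c * real_of_int d / 5
      else if cong_mat5 a b c d 0 1 (-1) 0 then - 5 + 4 * real_of_int d / 5 - 8 * real_of_int a * real_of_int b / 5 - 8 * real_of_int c * real_of_int d / 5
      else 0)"

definition nu_P :: "int \<Rightarrow> int \<Rightarrow> int \<Rightarrow> int \<Rightarrow> complex" where
  "nu_P a b c d = nu_eta a b c d ^ 6 * exp (pi * \<i> / 5 * of_real (E_exp a b c d))"

end

theory Submission
  imports Defs "HOL-Probability.Characteristic_Functions" "HOL-Complex_Analysis.Complex_Analysis"
begin

text \<open>
  Up to a constant factor, \<open>theta (1/2 + r) (1/2 + s)\<close> is \<open>\<eta>\<^sup>3\<close> times the Klein form of the real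
  vector \<open>(r, s)\<close>, and Klein forms transform under \<open>SL(2, \<int>)\<close> without any multiplier, through
  \<open>(r, s) \<mapsto> (r, s) M\<close>. Hence a product of two such functions has weight one and the multiplier
  \<open>\<nu>\<^sub>\<eta>\<^sup>6\<close>, in which the Jacobi symbols disappear; this is checked on the generators \<open>T\<close> and \<open>S\<close>,
  where \<open>\<nu>\<^sub>\<eta>\<^sup>6\<close> is \<open>\<i>\<close> both times, so that the eta function itself is never needed.
  The function \<open>P\<close> is the case of the vectors \<open>-(2/5) (1, 1)\<close> and \<open>-(2/5) (1, -1)\<close>. A matrix in the
  group permutes them up to signs and even integral vectors, and the quasi-periodicity of the Klein
  forms yields the phase \<open>exp (\<pi> \<i> E / 5)\<close>.

  The behaviour under \<open>S\<close> is Poisson summation for the Gaussian: for imaginary \<open>\<tau>\<close> both sides are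
  continuous periodic functions with the same Fourier coefficients, hence equal by Stone--Weierstrass;
  analytic continuation covers the rest of the half plane.
\<close>

subsection \<open>Theta functions with real characteristics\<close>

text \<open>The characteristics are half of those in \<open>theta_char\<close>, so that integers act
  as translations of both \<open>a\<close> and \<open>b\<close>.\<close>

definition theta_term :: "real \<Rightarrow> real \<Rightarrow> complex \<Rightarrow> int \<Rightarrow> complex" where
  "theta_term a b \<tau> n = exp (pi * \<i> * ((of_int n + of_real a)\<^sup>2 * \<tau> + 2 * (of_int n + of_real a) * of_real b))"

definition theta :: "real \<Rightarrow> real \<Rightarrow> complex \<Rightarrow> complex" where
  "theta a b \<tau> = (\<Sum>\<^sub>\<infinity>n. theta_term a b \<tau> n)"

lemma theta_char_eq_theta: "theta_char e e' 0 \<tau> = theta (e / 2) (e' / 2) \<tau>"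
  unfolding theta_char_def theta_def theta_term_def
  by (intro infsum_cong arg_cong[of _ _ exp]) (simp add: field_simps power2_eq_square)

section \<open>Convergence and holomorphy of the theta series\<close>

lemma norm_theta_term: "norm (theta_term a b \<tau> n) = exp (- (pi * Im \<tau> * (of_int n + a)\<^sup>2))"
proof -
  have "(of_int n + of_real a :: complex) = of_real (of_int n + a)" by simp
  then show ?thesis
    unfolding theta_term_def norm_exp_eq_Re
    by (simp del: of_real_add flip: of_real_power)
qed

text \<open>The Gaussian is dominated by a geometric series because |n| \<le> n^2. The bound is
  uniform in \<open>b\<close>, in bounded \<open>a\<close> and in \<tau> away from the real
  axis.\<close>

lemma norm_theta_term_le:
  assumes "y > 0" "y \<le> Im \<tau>" "\<bar>a\<bar> \<le> R"
  shows "norm (theta_term a b \<tau> n) \<le> exp (pi * y * R\<^sup>2) * exp (- (pi * y / 2)) ^ nat \<bar>n\<bar>"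
proof -
  have n: "\<bar>real_of_int n\<bar> \<le> (real_of_int n)\<^sup>2"
  proof (cases "n = 0")
    case False
    then have "1 \<le> \<bar>real_of_int n\<bar>" by linarith
    then show ?thesis using self_le_power[of "\<bar>real_of_int n\<bar>" 2] by simp
  qed simp
  \<comment> \<open>The difference of the two sides is the square of n + 2a.\<close>
  have "(real_of_int n)\<^sup>2 \<le> 2 * (of_int n + a)\<^sup>2 + 2 * a\<^sup>2"
    using sum_squares_ge_zero[of "real_of_int n + 2 * a" 0] by (simp add: power2_eq_square algebra_simps)
  moreover have "a\<^sup>2 \<le> R\<^sup>2" using assms(3) by (metis abs_ge_zero power2_abs power_mono)
  ultimately have "\<bar>real_of_int n\<bar> / 2 - R\<^sup>2 \<le> (of_int n + a)\<^sup>2" using n by linarith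
  then have "pi * y * (\<bar>real_of_int n\<bar> / 2 - R\<^sup>2) \<le> pi * y * (of_int n + a)\<^sup>2"
    using assms by (intro mult_left_mono) auto
  also have "\<dots> \<le> pi * Im \<tau> * (of_int n + a)\<^sup>2"
    using assms by (intro mult_right_mono mult_left_mono) auto
  finally have "norm (theta_term a b \<tau> n) \<le> exp (pi * y * R\<^sup>2 + real (nat \<bar>n\<bar>) * (- (pi * y / 2)))"
    unfolding norm_theta_term by (simp add: algebra_simps)
  then show ?thesis by (simp only: exp_add exp_of_nat_mult)
qed

lemma summable_on_int_geometric:
  fixes q :: real
  assumes "0 \<le> q" "q < 1"
  shows "(\<lambda>n. c * q ^ nat \<bar>n\<bar>) summable_on (UNIV :: int set)"
proof -
  have nat: "(\<lambda>n. q ^ n) summable_on (UNIV :: nat set)"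
    using assms by (intro norm_summable_imp_summable_on) (simp add: summable_geometric power_abs)
  have "(\<lambda>n. q ^ nat \<bar>n\<bar>) summable_on range int"
    using nat by (subst summable_on_reindex) (auto simp: o_def)
  moreover have "(\<lambda>n. q ^ nat \<bar>n\<bar>) summable_on range (\<lambda>n. - int n)"
    using nat by (subst summable_on_reindex) (auto simp: o_def inj_on_def)
  ultimately have "(\<lambda>n. q ^ nat \<bar>n\<bar>) summable_on (range int \<union> range (\<lambda>n. - int n))"
    by (rule summable_on_union)
  moreover have "n \<in> range int \<union> range (\<lambda>n. - int n)" for n
    by (cases n rule: int_cases2) auto
  then have "range int \<union> range (\<lambda>n. - int n) = UNIV"
    by (rule UNIV_eq_I[symmetric])
  ultimately show ?thesis by (simp add: summable_on_cmult_right)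
qed

lemma summable_theta_majorant:
  "y > 0 \<Longrightarrow> (\<lambda>n. c * exp (- (pi * y / 2)) ^ nat \<bar>n\<bar>) summable_on (UNIV :: int set)"
  by (rule summable_on_int_geometric) auto

text \<open>Weierstrass M-test. All three parameters depend on \<open>x\<close>, so that the lemma
  gives holomorphy in \<tau> as well as continuity in either characteristic.\<close>

lemma uniform_limit_theta_term:
  assumes "y > 0" "\<And>x. x \<in> X \<Longrightarrow> y \<le> Im (t x)" "\<And>x. x \<in> X \<Longrightarrow> \<bar>a x\<bar> \<le> R"
  shows "uniform_limit X (\<lambda>F x. \<Sum>n\<in>F. theta_term (a x) (b x) (t x) n)
           (\<lambda>x. theta (a x) (b x) (t x)) (finite_subsets_at_top UNIV)"
  unfolding theta_def
  by (rule Weierstrass_m_test_general[OF _ summable_theta_majorant[OF assms(1), of "exp (pi * y * R\<^sup>2)"]])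
     (use norm_theta_term_le assms in auto)

lemma theta_holomorphic: "theta a b holomorphic_on {\<tau>. Im \<tau> > 0}"
proof -
  \<comment> \<open>On this ball the imaginary part stays above \<open>Im z / 2\<close>, hence the
    partial sums converge uniformly there.\<close>
  have "theta a b holomorphic_on ball z (Im z / 2)" if "Im z > 0" for z
  proof (rule holomorphic_uniform_limit)
    have "Im z / 2 \<le> Im w" if "w \<in> cball z (Im z / 2)" for w
      using that abs_Im_le_cmod[of "z - w"] by (auto simp: dist_norm abs_if split: if_splits)
    then show "uniform_limit (cball z (Im z / 2)) (\<lambda>F \<tau>. \<Sum>n\<in>F. theta_term a b \<tau> n) (theta a b)
        (finite_subsets_at_top UNIV)"
      using \<open>Im z > 0\<close> by (intro uniform_limit_theta_term[of "Im z / 2" _ _ _ "\<bar>a\<bar>"]) auto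
    show "\<forall>\<^sub>F F in finite_subsets_at_top UNIV.
        continuous_on (cball z (Im z / 2)) (\<lambda>\<tau>. \<Sum>n\<in>F. theta_term a b \<tau> n) \<and>
        (\<lambda>\<tau>. \<Sum>n\<in>F. theta_term a b \<tau> n) holomorphic_on ball z (Im z / 2)"
      unfolding theta_term_def
      by (intro always_eventually allI conjI continuous_intros holomorphic_intros)
  qed auto
  then have "theta a b holomorphic_on (\<Union>z\<in>{z. Im z > 0}. ball z (Im z / 2))"
    by (subst holomorphic_on_UN_open) auto
  then show ?thesis
    by (rule holomorphic_on_subset) auto
qed

section \<open>Quasi-periodicity in the characteristics and in \<tau>\<close>

lemma theta_translate_left: "theta (a + of_int k) b \<tau> = theta a b \<tau>"
proof -
  have "theta_term (a + of_int k) b \<tau> n = theta_term a b \<tau> (n + k)" for n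
    by (simp add: theta_term_def add_ac)
  then have "theta (a + of_int k) b \<tau> = (\<Sum>\<^sub>\<infinity>n. theta_term a b \<tau> (n + k))"
    by (simp add: theta_def)
  also have "\<dots> = theta a b \<tau>"
    unfolding theta_def
    by (rule infsum_reindex_bij_witness[of _ "\<lambda>n. n - k" "\<lambda>n. n + k"]) auto
  finally show ?thesis .
qed

lemma exp_2pi_i_int: "exp (2 * pi * \<i> * of_int n) = 1"
  using exp_integer_2pi[of "of_int n"] by (simp add: mult_ac)

lemma theta_translate_right: "theta a (b + of_int k) \<tau> = exp (2 * pi * \<i> * (of_int k * of_real a)) * theta a b \<tau>"
proof -
  have "theta_term a (b + of_int k) \<tau> n = exp (2 * pi * \<i> * (of_int k * of_real a)) * theta_term a b \<tau> n" for n
  proof -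
    have "theta_term a (b + of_int k) \<tau> n =
        exp (2 * pi * \<i> * (of_int k * of_real a)) * theta_term a b \<tau> n * exp (2 * pi * \<i> * of_int (n * k))"
      unfolding theta_term_def exp_add[symmetric]
      by (intro arg_cong[of _ _ exp]) (simp add: algebra_simps)
    then show ?thesis by (simp only: exp_2pi_i_int mult_1_right)
  qed
  then show ?thesis
    by (simp add: theta_def infsum_cmult_right')
qed

lemma theta_minus: "theta (- a) (- b) \<tau> = theta a b \<tau>"
proof -
  have "theta_term (- a) (- b) \<tau> n = theta_term a b \<tau> (- n)" for n
    unfolding theta_term_def
    by (intro arg_cong[of _ _ exp]) (simp add: algebra_simps power2_eq_square)
  then have "theta (- a) (- b) \<tau> = (\<Sum>\<^sub>\<infinity>n. theta_term a b \<tau> (- n))"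
    by (simp add: theta_def)
  also have "\<dots> = theta a b \<tau>"
    unfolding theta_def
    by (rule infsum_reindex_bij_witness[of _ uminus uminus]) auto
  finally show ?thesis .
qed

text \<open>The new factor exp(pi i (n+a)^2) is linear in n up to a constant, since n^2 and n have
  the same parity: modulo 2, (n+a)^2 equals 2(n+a)(a+1/2) - a(a+1).\<close>

lemma theta_plus_1:
  "theta a b (\<tau> + 1) = exp (- (pi * \<i> * (of_real a * (of_real a + 1)))) * theta a (b + a + 1/2) \<tau>"
proof -
  have "theta_term a b (\<tau> + 1) n = exp (- (pi * \<i> * (of_real a * (of_real a + 1)))) * theta_term a (b + a + 1/2) \<tau> n" for n
  proof -
    have "even (n * (n + 1))" by simp
    then obtain m where m: "n * (n + 1) = 2 * m" by blast
    have "complex_of_int n * (of_int n + 1) = of_int (n * (n + 1))" by simp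
    then have m': "complex_of_int n * complex_of_int n = 2 * of_int m - of_int n"
      unfolding m by (simp add: algebra_simps)
    have "theta_term a b (\<tau> + 1) n = exp (- (pi * \<i> * (of_real a * (of_real a + 1)))) *
        theta_term a (b + a + 1/2) \<tau> n * exp (2 * pi * \<i> * of_int (m - n))"
      unfolding theta_term_def exp_add[symmetric]
      by (intro arg_cong[of _ _ exp]) (simp add: algebra_simps power2_eq_square m')
    then show ?thesis by (simp only: exp_2pi_i_int mult_1_right)
  qed
  then show ?thesis
    by (simp add: theta_def infsum_cmult_right')
qed

subsection \<open>Uniqueness of Fourier coefficients\<close>

definition wave :: "int \<Rightarrow> real \<Rightarrow> complex" where
  "wave m x = exp (2 * pi * \<i> * (of_int m * of_real x))"

lemma continuous_on_wave [continuous_intros]: "continuous_on S (wave m)"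
  unfolding wave_def by (intro continuous_intros)

lemma wave_0: "wave 0 x = 1"
  by (simp add: wave_def)

lemma wave_mult: "wave m x * wave n x = wave (m + n) x"
  by (simp add: wave_def exp_add[symmetric] algebra_simps)

lemma wave_1_eq_cis: "wave 1 x = cis (2 * pi * x)"
  by (simp add: wave_def cis_conv_exp mult_ac)

lemma wave_minus_1: "wave (- 1) x = cnj (wave 1 x)"
  by (simp add: wave_def exp_cnj)

lemma norm_wave [simp]: "norm (wave m x) = 1"
  by (simp add: wave_def)

lemma integral_wave: "integral {0..1} (wave m) = (if m = 0 then 1 else 0)"
proof (cases "m = 0")
  case False
  have "((\<lambda>x. exp ((2 * pi * \<i> * of_int m) * of_real x) / (2 * pi * \<i> * of_int m)) has_vector_derivative
      wave m x) (at x within {0..1})" for x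
    using False unfolding wave_def
    by (auto intro!: derivative_eq_intros has_vector_derivative_real_field simp: field_simps)
  then have "(wave m has_integral
      exp ((2 * pi * \<i> * of_int m) * of_real 1) / (2 * pi * \<i> * of_int m) -
      exp ((2 * pi * \<i> * of_int m) * of_real 0) / (2 * pi * \<i> * of_int m)) {0..1}"
    by (intro fundamental_theorem_of_calculus) auto
  then show ?thesis
    using False exp_2pi_i_int[of m] by (auto dest: integral_unique)
qed (simp add: wave_def [abs_def])

text \<open>Continuity is included because it makes the integrals additive; the class is then a
  vector space that is also closed under multiplication by waves.\<close>

definition fourier_null :: "(real \<Rightarrow> complex) \<Rightarrow> bool" where
  "fourier_null k \<longleftrightarrow> continuous_on {0..1} k \<and> (\<forall>m. integral {0..1} (\<lambda>x. k x * wave m x) = 0)"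

lemma fourier_null_cmult: "fourier_null k \<Longrightarrow> fourier_null (\<lambda>x. c * k x)"
  unfolding fourier_null_def by (auto intro!: continuous_intros simp: mult.assoc)

lemma fourier_null_add:
  assumes "fourier_null k" "fourier_null l"
  shows "fourier_null (\<lambda>x. k x + l x)"
proof -
  have "integral {0..1} (\<lambda>x. k x * wave m x + l x * wave m x) = 0" for m
    using assms unfolding fourier_null_def
    by (subst integral_add) (auto intro!: integrable_continuous_real continuous_intros)
  then show ?thesis
    using assms unfolding fourier_null_def by (auto intro!: continuous_intros simp: algebra_simps)
qed

lemma fourier_null_wave: "fourier_null k \<Longrightarrow> fourier_null (\<lambda>x. k x * wave j x)"
  unfolding fourier_null_def by (auto intro!: continuous_intros simp: mult.assoc wave_mult)

text \<open>
  Both factors of a product are handled in turn because the claim is made for every \<open>k\<close>, in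
  particular for \<open>k\<close> times the first factor.
\<close>

lemma fourier_null_polynomial:
  "real_polynomial_function p \<Longrightarrow> fourier_null k \<Longrightarrow> fourier_null (\<lambda>x. k x * of_real (p (wave 1 x)))"
proof (induction p arbitrary: k rule: real_polynomial_function.induct)
  case (linear p)
  interpret bounded_linear p by fact
  \<comment> \<open>A real linear form on the plane is A z + B cnj z; on the unit circle z and cnj z
    are \<open>wave 1\<close> and \<open>wave (- 1)\<close>.\<close>
  define A where "A = (of_real (p 1) - \<i> * of_real (p \<i>)) / 2"
  define B where "B = (of_real (p 1) + \<i> * of_real (p \<i>)) / 2"
  have p: "p z = Re z * p 1 + Im z * p \<i>" for z
  proof -
    have "z = Re z *\<^sub>R 1 + Im z *\<^sub>R \<i>" by (simp add: complex_eq_iff)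
    then show ?thesis by (metis add scale real_scaleR_def)
  qed
  have "of_real (p z) = A * z + B * cnj z" for z
    by (subst p) (simp add: A_def B_def complex_eq_iff field_simps)
  then have "k x * of_real (p (wave 1 x)) = A * (k x * wave 1 x) + B * (k x * wave (- 1) x)" for x
    by (simp add: wave_minus_1 algebra_simps)
  moreover have "fourier_null (\<lambda>x. A * (k x * wave 1 x) + B * (k x * wave (- 1) x))"
    by (intro fourier_null_add fourier_null_cmult fourier_null_wave \<open>fourier_null k\<close>)
  ultimately show ?case by simp
next
  case (const c)
  then show ?case using fourier_null_cmult[of k "of_real c"] by (simp add: mult.commute)
next
  case (add p q)
  then show ?case
    using fourier_null_add[OF add.IH(1)[OF add.prems] add.IH(2)[OF add.prems]] by (simp add: algebra_simps)
next
  case (mult p q)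
  then show ?case
    using mult.IH(2)[OF mult.IH(1)[OF mult.prems]] by (simp add: mult.assoc)
qed

lemma periodic_add_int:
  fixes f :: "real \<Rightarrow> 'a"
  assumes "\<And>x. f (x + 1) = f x"
  shows "f (x + of_int n) = f x"
proof (induction n rule: int_induct[where k = 0])
  case (step1 i)
  then show ?case using assms[of "x + of_int i"] by (simp add: add_ac)
next
  case (step2 i)
  then show ?case using assms[of "x + of_int (i - 1)"] by (simp add: add_ac)
qed simp

text \<open>The principal argument jumps across the negative real axis, so continuity of
  \<open>g\<close> is checked on two open sets that cover the circle, with \<open>Arg z\<close> on
  one and \<open>Arg (- z)\<close> on the other.\<close>

lemma periodic_factors_through_circle:
  fixes f :: "real \<Rightarrow> complex"
  assumes cont: "continuous_on UNIV f" and per: "\<And>x. f (x + 1) = f x"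
  obtains g where "continuous_on (sphere 0 1) g" "\<And>x. g (wave 1 x) = f x"
proof
  define g where "g z = f (Arg z / (2 * pi))" for z
  have eq: "f x = f y" if "wave 1 x = wave 1 y" for x y
  proof -
    obtain n :: int where "2 * pi * \<i> * of_real x = 2 * pi * \<i> * of_real y + (of_int (2 * n) * pi) * \<i>"
      using \<open>wave 1 x = wave 1 y\<close> unfolding wave_def exp_eq by auto
    then have "2 * pi * \<i> * of_real x = 2 * pi * \<i> * of_real (y + of_int n)"
      by (simp add: algebra_simps)
    then have "x = y + of_int n"
      by (simp del: of_real_add)
    then show ?thesis using periodic_add_int[of f, OF per] by simp
  qed
  have Arg: "wave 1 (Arg z / (2 * pi)) = z / norm z" if "z \<noteq> 0" for z
    using that Arg_eq[of z] by (simp add: wave_def field_simps)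
  show g_wave: "g (wave 1 x) = f x" for x
    unfolding g_def by (rule eq) (use Arg[of "wave 1 x"] norm_wave[of 1 x] in fastforce)
  \<comment> \<open>\<open>Arg (- z)\<close> is continuous off the nonnegative reals, and the half
    period \<open>1 / 2\<close> undoes the sign.\<close>
  have g_minus: "g z = f (Arg (- z) / (2 * pi) + 1 / 2)" if "z \<noteq> 0" for z
    unfolding g_def
  proof (rule eq)
    have "wave 1 (Arg (- z) / (2 * pi) + 1 / 2) = - wave 1 (Arg (- z) / (2 * pi))"
      by (simp add: wave_1_eq_cis distrib_left flip: cis_mult)
    then show "wave 1 (Arg z / (2 * pi)) = wave 1 (Arg (- z) / (2 * pi) + 1 / 2)"
      using Arg[OF that] Arg[of "- z"] that by simp
  qed
  have [continuous_intros]: "continuous_on S (\<lambda>x. f (h x))" if "continuous_on S h" for S :: "complex set" and h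
    using that by (intro continuous_on_compose2[OF cont]) auto
  have "continuous_on (- \<real>\<^sub>\<le>\<^sub>0) g"
    unfolding g_def by (intro continuous_intros) auto
  moreover have "continuous_on {z. - z \<notin> \<real>\<^sub>\<le>\<^sub>0} (\<lambda>z. f (Arg (- z) / (2 * pi) + 1 / 2))"
    by (intro continuous_intros) auto
  then have "continuous_on {z. - z \<notin> \<real>\<^sub>\<le>\<^sub>0} g"
    by (rule continuous_on_eq) (auto intro!: g_minus[symmetric])
  moreover have "open {z::complex. - z \<notin> \<real>\<^sub>\<le>\<^sub>0}"
    using open_vimage[of "- \<real>\<^sub>\<le>\<^sub>0" "uminus :: complex \<Rightarrow> complex"]
    by (simp add: vimage_def closed_nonpos_Reals_complex open_Compl continuous_intros)
  ultimately have "continuous_on (- \<real>\<^sub>\<le>\<^sub>0 \<union> {z. - z \<notin> \<real>\<^sub>\<le>\<^sub>0}) g"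
    by (intro continuous_on_open_Un) (auto simp: closed_nonpos_Reals_complex open_Compl)
  then show "continuous_on (sphere 0 1) g"
    by (rule continuous_on_subset) (auto simp: complex_nonpos_Reals_iff norm_complex_def)
qed

text \<open>Approximate the conjugate of \<open>f\<close> on the circle by a polynomial q within e.
  Since f q has integral 0, the integral of |f|^2 is that of f (cnj f - q), hence at most C e, where
  C bounds |f|. So |f|^2 has integral 0.\<close>

lemma fourier_unique:
  assumes cont: "continuous_on UNIV f" and per: "\<And>x. f (x + 1) = f x"
    and coeff: "\<And>m. integral {0..1} (\<lambda>x. f x * wave m x) = 0"
  shows "f x = 0"
proof -
  have f_null: "fourier_null f"
    using coeff continuous_on_subset[OF cont] by (auto simp: fourier_null_def)
  obtain g where g: "continuous_on (sphere 0 1) g" "\<And>x. g (wave 1 x) = cnj (f x)"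
    using periodic_factors_through_circle[of "\<lambda>x. cnj (f x)"] cont per
    by (metis continuous_on_cnj)
  have [continuous_intros]: "continuous_on {0..1} f" using cont continuous_on_subset by blast
  have "bounded (f ` {0..1})"
    by (intro compact_imp_bounded compact_continuous_image continuous_intros compact_Icc)
  then obtain C where C: "\<And>x. x \<in> {0..1} \<Longrightarrow> norm (f x) \<le> C"
    unfolding bounded_iff by blast
  have "C \<ge> 0" using order_trans[OF norm_ge_zero C[of 0]] by simp
  have small: "integral {0..1} (\<lambda>x. (norm (f x))\<^sup>2) \<le> C * e" if "e > 0" for e
  proof -
    obtain q where q: "polynomial_function q" "\<And>z. z \<in> sphere 0 1 \<Longrightarrow> norm (g z - q z) < e"
      using Stone_Weierstrass_polynomial_function[OF _ g(1) \<open>e > 0\<close>] by auto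
    \<comment> \<open>Real and imaginary parts are treated apart because
      \<open>fourier_null_polynomial\<close> concerns real-valued polynomials.\<close>
    have "real_polynomial_function (\<lambda>z. Re (q z))" "real_polynomial_function (\<lambda>z. Im (q z))"
      using q(1) bounded_linear_Re bounded_linear_Im unfolding polynomial_function_def o_def by auto
    then have "fourier_null (\<lambda>x. f x * of_real (Re (q (wave 1 x))) + \<i> * (f x * of_real (Im (q (wave 1 x)))))"
      by (intro fourier_null_add fourier_null_cmult fourier_null_polynomial f_null)
    moreover have "f x * of_real (Re (q (wave 1 x))) + \<i> * (f x * of_real (Im (q (wave 1 x)))) =
        f x * q (wave 1 x)" for x
      by (subst (5) complex_eq) (simp add: algebra_simps)
    ultimately have "fourier_null (\<lambda>x. f x * q (wave 1 x))" by simp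
    \<comment> \<open>The vanishing integral is the Fourier coefficient with
      \<open>m = 0\<close>.\<close>
    then have fq: "continuous_on {0..1} (\<lambda>x. f x * q (wave 1 x))"
        "integral {0..1} (\<lambda>x. f x * q (wave 1 x)) = 0"
      using wave_0 unfolding fourier_null_def by (simp, metis (no_types, lifting) integral_cong mult_1_right)
    have "of_real (integral {0..1} (\<lambda>x. (norm (f x))\<^sup>2)) = integral {0..1} (\<lambda>x. f x * cnj (f x))"
      by (subst integral_linear[OF _ bounded_linear_of_real, symmetric])
         (auto intro!: integrable_continuous_real continuous_intros simp: o_def simp flip: complex_norm_square)
    also have "\<dots> = integral {0..1} (\<lambda>x. f x * cnj (f x) - f x * q (wave 1 x))"
      using fq by (subst integral_diff) (auto intro!: integrable_continuous_real continuous_intros)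
    finally have eq: "of_real (integral {0..1} (\<lambda>x. (norm (f x))\<^sup>2)) =
        integral {0..1} (\<lambda>x. f x * cnj (f x) - f x * q (wave 1 x))" .
    have "norm (integral {0..1} (\<lambda>x. f x * cnj (f x) - f x * q (wave 1 x))) \<le> C * e * (1 - 0)"
    proof (rule integral_bound)
      fix x :: real assume "x \<in> {0..1}"
      have "norm (f x * cnj (f x) - f x * q (wave 1 x)) = norm (f x) * norm (g (wave 1 x) - q (wave 1 x))"
        by (simp add: g(2) norm_mult flip: right_diff_distrib)
      also have "\<dots> \<le> C * e"
        using C[OF \<open>x \<in> {0..1}\<close>] q(2)[of "wave 1 x"] \<open>C \<ge> 0\<close> by (intro mult_mono) auto
      finally show "norm (f x * cnj (f x) - f x * q (wave 1 x)) \<le> C * e" .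
    qed (auto intro!: continuous_intros fq)
    then have "\<bar>integral {0..1} (\<lambda>x. (norm (f x))\<^sup>2)\<bar> \<le> C * e"
      unfolding eq[symmetric] by simp
    then show ?thesis by linarith
  qed
  have "integral {0..1} (\<lambda>x. (norm (f x))\<^sup>2) \<le> 0"
  proof (rule field_le_epsilon)
    fix e :: real assume "e > 0"
    \<comment> \<open>Dividing by \<open>C + 1\<close> avoids division by zero when \<open>C\<close>
      is 0.\<close>
    have "C * (e / (C + 1)) \<le> e"
      using \<open>e > 0\<close> \<open>C \<ge> 0\<close> by (simp add: field_simps)
    then show "integral {0..1} (\<lambda>x. (norm (f x))\<^sup>2) \<le> 0 + e"
      using small[of "e / (C + 1)"] \<open>e > 0\<close> \<open>C \<ge> 0\<close> by simp
  qed
  then have "integral {0..1} (\<lambda>x. (norm (f x))\<^sup>2) = 0"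
    by (intro antisym integral_nonneg) (auto intro!: integrable_continuous_real continuous_intros)
  then have "f y = 0" if "y \<in> {0..1}" for y
    using that by (subst (asm) integral_eq_0_iff) (auto intro!: continuous_intros)
  then have "f (frac x) = 0" by (simp add: frac_ge_0 frac_lt_1 less_imp_le)
  then show ?thesis
    using periodic_add_int[of f, OF per, of "frac x" "\<lfloor>x\<rfloor>"] by (simp add: frac_def)
qed

subsection \<open>Poisson summation and the inversion formula\<close>

text \<open>Sum and integral are interchanged by uniform convergence under the majorant
  \<open>M\<close>.\<close>

lemma has_sum_integral:
  fixes v :: "'a \<Rightarrow> real \<Rightarrow> complex"
  assumes "\<And>n x. x \<in> {0..1} \<Longrightarrow> norm (v n x) \<le> M n" "M summable_on UNIV"
    "\<And>n. continuous_on {0..1} (v n)"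
  shows "((\<lambda>n. integral {0..1} (v n)) has_sum integral {0..1} (\<lambda>x. \<Sum>\<^sub>\<infinity>n. v n x)) UNIV"
proof -
  have "uniform_limit {0..1} (\<lambda>F x. \<Sum>n\<in>F. v n x) (\<lambda>x. \<Sum>\<^sub>\<infinity>n. v n x) (finite_subsets_at_top UNIV)"
    by (rule Weierstrass_m_test_general) (use assms in auto)
  then obtain I J where IJ: "\<And>F. ((\<lambda>x. \<Sum>n\<in>F. v n x) has_integral I F) {0..1}"
      "((\<lambda>x. \<Sum>\<^sub>\<infinity>n. v n x) has_integral J) {0..1}" "(I \<longlongrightarrow> J) (finite_subsets_at_top UNIV)"
    by (rule uniform_limit_integral) (use assms in \<open>auto intro!: continuous_intros\<close>)
  have "I F = (\<Sum>n\<in>F. integral {0..1} (v n))" if "finite F" for F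
    using integral_unique[OF IJ(1)[of F]] that assms
    by (subst (asm) integral_sum) (auto intro!: integrable_continuous_real)
  then have "\<forall>\<^sub>F F in finite_subsets_at_top UNIV. I F = (\<Sum>n\<in>F. integral {0..1} (v n))"
    by (auto intro: eventually_finite_subsets_at_top_weakI)
  with IJ(3) have "((\<lambda>F. \<Sum>n\<in>F. integral {0..1} (v n)) \<longlongrightarrow> J) (finite_subsets_at_top UNIV)"
    by (rule Lim_transform_eventually)
  then show ?thesis
    using integral_unique[OF IJ(2)] by (simp add: has_sum_def)
qed

text \<open>The intervals from -N to N eventually contain every finite set of integers. This turns
  an unordered sum into a sequence that can be compared with integrals over growing
  intervals.\<close>

lemma has_sum_int_symmetric_limit:
  fixes f :: "int \<Rightarrow> 'a::{comm_monoid_add, topological_space}"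
  assumes "(f has_sum S) UNIV"
  shows "(\<lambda>N. \<Sum>n=-int N..int N. f n) \<longlonglongrightarrow> S"
proof -
  have "filterlim (\<lambda>N. {-int N..int N}) (finite_subsets_at_top UNIV) sequentially"
    unfolding filterlim_finite_subsets_at_top
  proof (intro allI impI)
    fix X :: "int set" assume "finite X \<and> X \<subseteq> UNIV"
    then have "finite X" by simp
    define B where "B = Max (abs ` X)"
    have B: "\<bar>x\<bar> \<le> B" if "x \<in> X" for x
      using \<open>finite X\<close> that by (simp add: B_def)
    show "\<forall>\<^sub>F N in sequentially. finite {- int N..int N} \<and> X \<subseteq> {- int N..int N} \<and> {- int N..int N} \<subseteq> UNIV"
      using eventually_ge_at_top[of "nat \<bar>B\<bar>"]
    proof eventually_elim
      case (elim N)
      have "- int N \<le> x \<and> x \<le> int N" if "x \<in> X" for x using B[OF that] elim by linarith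
      then show ?case by auto
    qed
  qed
  with assms show ?thesis
    unfolding has_sum_def by (rule filterlim_compose)
qed

text \<open>The unit intervals starting at -N, ..., N tile the interval from -N to N + 1, whence the
  asymmetric upper end.\<close>

lemma sum_integral_shifts:
  fixes h :: "real \<Rightarrow> complex"
  assumes "continuous_on UNIV h"
  shows "(\<Sum>n=-int N..int N. integral {0..1} (\<lambda>x. h (of_int n + x))) = integral {- real N..real N + 1} h"
proof (induction N)
  case 0
  then show ?case by simp
next
  case (Suc N)
  have int: "h integrable_on {a..b}" for a b
    using assms by (intro integrable_continuous_real) (rule continuous_on_subset, auto)
  define g where "g n = integral {0..1} (\<lambda>x. h (of_int n + x))" for n :: int
  have shift: "g n = integral {of_int n..of_int n + 1} h" for n
    using integral_shift_Icc_real[of 0 1 h "of_int n"] by (simp add: g_def o_def add.commute)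
  have "{- int (Suc N)..int (Suc N)} = insert (- int (Suc N)) (insert (int (Suc N)) {-int N..int N})"
    by auto
  then have "(\<Sum>n=-int (Suc N)..int (Suc N). g n) = g (- int (Suc N)) + g (int (Suc N)) + (\<Sum>n=-int N..int N. g n)"
    by simp
  also have "\<dots> = integral {- real N - 1..- real N} h + integral {real N + 1..real N + 2} h + integral {- real N..real N + 1} h"
  proof -
    have "g (- int (Suc N)) = integral {- real N - 1..- real N} h"
      unfolding shift by (rule arg_cong2[where f = integral]) auto
    moreover have "g (int (Suc N)) = integral {real N + 1..real N + 2} h"
      unfolding shift by (rule arg_cong2[where f = integral]) auto
    ultimately show ?thesis using Suc by (simp flip: g_def)
  qed
  also have "\<dots> = integral {- real (Suc N)..real (Suc N) + 1} h"
  proof -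
    note combine = Henstock_Kurzweil_Integration.integral_combine[where f = h, symmetric]
    have ivl: "{- real (Suc N)..real (Suc N) + 1} = {- real N - 1..real N + 2}" by auto
    show ?thesis
      unfolding ivl
      using combine[of "- real N - 1" "real N + 1" "real N + 2", OF _ _ int]
        combine[of "- real N - 1" "- real N" "real N + 1", OF _ _ int]
      by simp
  qed
  finally show ?case unfolding g_def .
qed

text \<open>Dominated convergence with majorant |h|; it links the gauge integrals over bounded
  intervals with the Lebesgue integral over the line.\<close>

lemma integral_symmetric_limit:
  fixes h :: "real \<Rightarrow> complex"
  assumes "has_bochner_integral lborel h I"
  shows "(\<lambda>N. integral {- real N..real N + 1} h) \<longlonglongrightarrow> I"
proof -
  have h: "integrable lborel h" "integral\<^sup>L lborel h = I"
    using assms by (auto simp: has_bochner_integral_iff)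
  have "(\<lambda>N. LINT x|lborel. indicator {- real N..real N + 1} x *\<^sub>R h x) \<longlonglongrightarrow> (LINT x|lborel. h x)"
  proof (rule integral_dominated_convergence)
    show "integrable lborel (\<lambda>x. norm (h x))" using h by simp
    show "AE x in lborel. (\<lambda>N. indicator {- real N..real N + 1} x *\<^sub>R h x) \<longlonglongrightarrow> h x"
    proof (rule AE_I2)
      fix x :: real
      have "\<forall>\<^sub>F N in sequentially. indicator {- real N..real N + 1} x *\<^sub>R h x = h x"
        using eventually_ge_at_top[of "nat \<lceil>\<bar>x\<bar>\<rceil>"]
      proof eventually_elim
        case (elim N)
        then have "\<bar>x\<bar> \<le> real N" by linarith
        then show ?case by (auto simp: indicator_def)
      qed
      then show "(\<lambda>N. indicator {- real N..real N + 1} x *\<^sub>R h x) \<longlonglongrightarrow> h x"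
        by (rule tendsto_eventually)
    qed
  qed (use h in \<open>auto simp: indicator_def\<close>)
  moreover have "(LINT x|lborel. indicator {- real N..real N + 1} x *\<^sub>R h x) = integral {- real N..real N + 1} h" for N
    using set_borel_integral_eq_integral(2)[of "{- real N..real N + 1}" h] h(1)
    by (simp add: set_integrable_def set_lebesgue_integral_def integrable_mult_indicator)
  ultimately show ?thesis using h(2) by simp
qed

text \<open>This is the characteristic function of the standard normal distribution after a linear
  substitution.\<close>

lemma gaussian_fourier_transform:
  fixes t u :: real
  assumes "t > 0"
  shows "has_bochner_integral lborel (\<lambda>x. exp (of_real (- (pi * t * x\<^sup>2)) + 2 * pi * \<i> * of_real (u * x)))
    (of_real (exp (- (pi * u\<^sup>2 / t)) / sqrt t))"
proof -
  \<comment> \<open>With this \<open>c\<close> the normal exponent (cx)^2/2 becomes pi t x^2, and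
    \<open>s\<close> is chosen so that s c x = 2 pi u x.\<close>
  define c where "c = sqrt (2 * pi * t)"
  define s where "s = 2 * pi * u / c"
  have c: "c > 0" "c\<^sup>2 = 2 * pi * t" using assms by (auto simp: c_def)
  have int: "integrable std_normal_distribution (\<lambda>x. iexp (s * x))"
  proof -
    interpret prob_space std_normal_distribution by (rule prob_space_normal_density) simp
    show ?thesis by (rule integrable_const_bound[where B = 1]) auto
  qed
  have "has_bochner_integral std_normal_distribution (\<lambda>x. iexp (s * x)) (of_real (exp (- s\<^sup>2 / 2)))"
    using int char_std_normal_distribution
    by (simp add: has_bochner_integral_iff char_def fun_eq_iff)
  then have "has_bochner_integral lborel (\<lambda>x. std_normal_density x *\<^sub>R iexp (s * x)) (of_real (exp (- s\<^sup>2 / 2)))"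
    by (simp add: has_bochner_integral_iff integrable_density integral_density)
  then have "has_bochner_integral lborel (\<lambda>x. std_normal_density (0 + c * x) *\<^sub>R iexp (s * (0 + c * x)))
      (of_real (exp (- s\<^sup>2 / 2)) /\<^sub>R \<bar>c\<bar>)"
    using c by (subst lborel_has_bochner_integral_real_affine_iff[symmetric]) auto
  then have "has_bochner_integral lborel (\<lambda>x. sqrt (2 * pi) *\<^sub>R (std_normal_density (0 + c * x) *\<^sub>R iexp (s * (0 + c * x))))
      (sqrt (2 * pi) *\<^sub>R (of_real (exp (- s\<^sup>2 / 2)) /\<^sub>R \<bar>c\<bar>))"
    by (rule has_bochner_integral_scaleR_right)
  moreover have "sqrt (2 * pi) *\<^sub>R (std_normal_density (0 + c * x) *\<^sub>R iexp (s * (0 + c * x))) =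
      exp (of_real (- (pi * t * x\<^sup>2)) + 2 * pi * \<i> * of_real (u * x))" for x
  proof -
    have "(c * x)\<^sup>2 / 2 = pi * t * x\<^sup>2" by (simp add: power_mult_distrib c)
    then have "sqrt (2 * pi) * std_normal_density (0 + c * x) = exp (- (pi * t * x\<^sup>2))"
      by (simp add: std_normal_density_def)
    moreover have "s * (0 + c * x) = 2 * pi * (u * x)" using c by (simp add: s_def)
    moreover have "exp (of_real (- (pi * t * x\<^sup>2)) + 2 * pi * \<i> * of_real (u * x)) =
        exp (- (pi * t * x\<^sup>2)) *\<^sub>R iexp (2 * pi * (u * x))"
      by (simp only: exp_add exp_of_real scaleR_conv_of_real) (simp add: mult_ac)
    ultimately show ?thesis
      by (simp only: scaleR_scaleR)
  qed
  moreover have "sqrt (2 * pi) *\<^sub>R (of_real (exp (- s\<^sup>2 / 2)) /\<^sub>R \<bar>c\<bar>) = complex_of_real (exp (- (pi * u\<^sup>2 / t)) / sqrt t)"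
  proof -
    have "s\<^sup>2 / 2 = pi * u\<^sup>2 / t"
      using assms by (simp add: s_def power_divide power_mult_distrib c) (simp add: field_simps power2_eq_square)
    moreover have "sqrt (2 * pi) / c = 1 / sqrt t"
      using assms by (simp add: c_def real_sqrt_mult field_simps)
    ultimately show ?thesis using c(1)
      by (simp add: scaleR_conv_of_real field_simps flip: of_real_mult of_real_divide)
  qed
  ultimately show ?thesis by simp
qed

text \<open>As a function of its first characteristic, theta is a Gaussian summed over all integer
  shifts. Its Fourier coefficient therefore unfolds to an integral over the whole line, the Gaussian
  transform at \<open>b + of_int m\<close>.\<close>

lemma theta_fourier_coefficient:
  assumes "t > 0"
  shows "integral {0..1} (\<lambda>x. theta x b (\<i> * of_real t) * wave m x) =
    of_real (exp (- (pi * (b + of_int m)\<^sup>2 / t)) / sqrt t)"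
proof -
  define h :: "real \<Rightarrow> complex" where
    "h x = exp (of_real (- (pi * t * x\<^sup>2)) + 2 * pi * \<i> * of_real ((b + of_int m) * x))" for x
  have term_eq: "theta_term x b (\<i> * of_real t) n * wave m x = h (of_int n + x)" for x n
  proof -
    have "h (of_int n + x) = theta_term x b (\<i> * of_real t) n * wave m x * exp (2 * pi * \<i> * of_int (m * n))"
      unfolding h_def theta_term_def wave_def exp_add[symmetric]
      by (intro arg_cong[of _ _ exp]) (simp add: algebra_simps power2_eq_square)
    then show ?thesis by (simp only: exp_2pi_i_int mult_1_right)
  qed
  have cont: "continuous_on UNIV h" unfolding h_def by (intro continuous_intros)
  have "((\<lambda>n. integral {0..1} (\<lambda>x. h (of_int n + x))) has_sum
      integral {0..1} (\<lambda>x. \<Sum>\<^sub>\<infinity>n. h (of_int n + x))) UNIV"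
  proof (rule has_sum_integral)
    show "norm (h (of_int n + x)) \<le> exp (pi * t * 1\<^sup>2) * exp (- (pi * t / 2)) ^ nat \<bar>n\<bar>" if "x \<in> {0..1}" for n x
      using norm_theta_term_le[of t "\<i> * of_real t" x 1 b n] that assms
      by (simp add: norm_mult flip: term_eq)
    show "continuous_on {0..1} (\<lambda>x. h (of_int n + x))" for n
      by (intro continuous_on_compose2[OF cont] continuous_intros) auto
  qed (rule summable_theta_majorant[OF assms])
  then have "((\<lambda>n. integral {0..1} (\<lambda>x. h (of_int n + x))) has_sum
      integral {0..1} (\<lambda>x. theta x b (\<i> * of_real t) * wave m x)) UNIV"
    by (simp add: theta_def infsum_cmult_left' flip: term_eq)
  then have "(\<lambda>N. integral {- real N..real N + 1} h) \<longlonglongrightarrow> integral {0..1} (\<lambda>x. theta x b (\<i> * of_real t) * wave m x)"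
    using has_sum_int_symmetric_limit by (fastforce simp: sum_integral_shifts[OF cont])
  moreover have "(\<lambda>N. integral {- real N..real N + 1} h) \<longlonglongrightarrow> of_real (exp (- (pi * (b + of_int m)\<^sup>2 / t)) / sqrt t)"
    unfolding h_def by (intro integral_symmetric_limit gaussian_fourier_transform assms)
  ultimately show ?thesis by (rule LIMSEQ_unique)
qed

text \<open>Here the series is already a Fourier series: the exponential prefactor turns its n-th
  term into a constant times \<open>wave n x\<close>. Orthogonality leaves only n = -m.\<close>

lemma dual_theta_fourier_coefficient:
  assumes "t > 0"
  shows "integral {0..1} (\<lambda>x. exp (2 * pi * \<i> * of_real (b * x)) * theta (- b) x (\<i> / of_real t) * wave m x) =
    of_real (exp (- (pi * (b + of_int m)\<^sup>2 / t)))"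
proof -
  define g where "g n = complex_of_real (exp (- (pi * (of_int n - b)\<^sup>2 / t)))" for n :: int
  have term_eq: "exp (2 * pi * \<i> * of_real (b * x)) * theta_term (- b) x (\<i> / of_real t) n = g n * wave n x" for x n
    unfolding g_def theta_term_def wave_def exp_add[symmetric] exp_of_real[symmetric]
    using assms by (intro arg_cong[of _ _ exp]) (simp add: field_simps power2_eq_square)
  have "((\<lambda>n. integral {0..1} (\<lambda>x. g n * wave n x * wave m x)) has_sum
      integral {0..1} (\<lambda>x. \<Sum>\<^sub>\<infinity>n. g n * wave n x * wave m x)) UNIV"
  proof (rule has_sum_integral)
    show "norm (g n * wave n x * wave m x) \<le> exp (pi * (1 / t) * \<bar>b\<bar>\<^sup>2) * exp (- (pi * (1 / t) / 2)) ^ nat \<bar>n\<bar>" for n x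
      using norm_theta_term_le[of "1 / t" "\<i> / of_real t" "- b" "\<bar>b\<bar>" x n] assms
      by (simp add: norm_mult flip: term_eq)
    show "(\<lambda>n. exp (pi * (1 / t) * \<bar>b\<bar>\<^sup>2) * exp (- (pi * (1 / t) / 2)) ^ nat \<bar>n\<bar>) summable_on (UNIV :: int set)"
      by (rule summable_theta_majorant) (use assms in simp)
  qed (auto intro!: continuous_intros)
  also have "(\<lambda>x. \<Sum>\<^sub>\<infinity>n. g n * wave n x * wave m x) =
      (\<lambda>x. exp (2 * pi * \<i> * of_real (b * x)) * theta (- b) x (\<i> / of_real t) * wave m x)"
    by (simp add: theta_def infsum_cmult_left' infsum_cmult_right' flip: term_eq)
  also have "(\<lambda>n. integral {0..1} (\<lambda>x. g n * wave n x * wave m x)) = (\<lambda>n. if n = - m then g (- m) else 0)"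
    by (auto simp: mult.assoc wave_mult integral_wave fun_eq_iff)
  finally have "infsum (\<lambda>n. if n = - m then g (- m) else 0) UNIV =
      integral {0..1} (\<lambda>x. exp (2 * pi * \<i> * of_real (b * x)) * theta (- b) x (\<i> / of_real t) * wave m x)"
    by (rule infsumI)
  moreover have "infsum (\<lambda>n. if n = - m then g (- m) else 0) UNIV = g (- m)"
    by (subst infsum_cong_neutral[where T = "{- m}"]) auto
  moreover have "(of_int (- m) - b)\<^sup>2 = (b + of_int m)\<^sup>2" by (simp add: power2_eq_square algebra_simps)
  ultimately show ?thesis by (simp add: g_def)
qed

text \<open>The majorant depends on a bound for the first characteristic, so continuity is proved on
  balls of radius 1; for the second characteristic it is uniform on the whole line.\<close>

lemma continuous_on_theta_left:
  assumes "Im \<tau> > 0"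
  shows "continuous_on UNIV (\<lambda>x. theta x b \<tau>)"
proof -
  have "continuous_on (ball y 1) (\<lambda>x. theta x b \<tau>)" for y
  proof (rule uniform_limit_theorem)
    have "\<bar>x\<bar> \<le> \<bar>y\<bar> + 1" if "x \<in> ball y 1" for x
      using that by (auto simp: dist_real_def)
    then show "uniform_limit (ball y 1) (\<lambda>F x. \<Sum>n\<in>F. theta_term x b \<tau> n) (\<lambda>x. theta x b \<tau>) (finite_subsets_at_top UNIV)"
      using assms by (intro uniform_limit_theta_term[of "Im \<tau>" _ _ _ "\<bar>y\<bar> + 1"]) auto
    show "\<forall>\<^sub>F F in finite_subsets_at_top UNIV. continuous_on (ball y 1) (\<lambda>x. \<Sum>n\<in>F. theta_term x b \<tau> n)"
      unfolding theta_term_def by (intro always_eventually allI continuous_intros)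
  qed auto
  then have "continuous_on (\<Union>y. ball y 1) (\<lambda>x. theta x b \<tau>)"
    by (intro continuous_on_open_UN) auto
  moreover have "x \<in> (\<Union>y::real. ball y 1)" for x
    by (rule UN_I[of x]) auto
  then have "(\<Union>y::real. ball y 1) = UNIV" by blast
  ultimately show ?thesis by simp
qed

lemma continuous_on_theta_right:
  assumes "Im \<tau> > 0"
  shows "continuous_on UNIV (\<lambda>x. theta a x \<tau>)"
proof (rule uniform_limit_theorem)
  show "uniform_limit UNIV (\<lambda>F x. \<Sum>n\<in>F. theta_term a x \<tau> n) (\<lambda>x. theta a x \<tau>) (finite_subsets_at_top UNIV)"
    using assms by (intro uniform_limit_theta_term[of "Im \<tau>" _ _ _ "\<bar>a\<bar>"]) auto
  show "\<forall>\<^sub>F F in finite_subsets_at_top UNIV. continuous_on UNIV (\<lambda>x. \<Sum>n\<in>F. theta_term a x \<tau> n)"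
    unfolding theta_term_def by (intro always_eventually allI continuous_intros)
qed auto

text \<open>With \<open>b\<close> fixed, both sides are continuous 1-periodic functions of
  \<open>a\<close> whose Fourier coefficients are the two Gaussian values computed above.\<close>

lemma theta_inversion_imaginary:
  assumes "t > 0"
  shows "of_real (sqrt t) * theta a b (\<i> * of_real t) = exp (2 * pi * \<i> * of_real (a * b)) * theta (- b) a (\<i> / of_real t)"
proof -
  define D where "D x = of_real (sqrt t) * theta x b (\<i> * of_real t) -
    exp (2 * pi * \<i> * of_real (b * x)) * theta (- b) x (\<i> / of_real t)" for x
  have [continuous_intros]: "continuous_on S (\<lambda>x. theta x b (\<i> * of_real t))"
      "continuous_on S (\<lambda>x. theta (- b) x (\<i> / of_real t))" for S
    using continuous_on_theta_left[of "\<i> * of_real t" b] continuous_on_theta_right[of "\<i> / of_real t" "- b"] assms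
    by (auto intro: continuous_on_subset)
  have "D a = 0"
  proof (rule fourier_unique)
    show "continuous_on UNIV D"
      unfolding D_def by (intro continuous_intros)
    show "D (x + 1) = D x" for x
    proof -
      \<comment> \<open>This factor cancels against the one that
        \<open>exp (2 * pi * \<i> * of_real (b * x))\<close> gains under the shift.\<close>
      have "theta (- b) (x + 1) (\<i> / of_real t) = exp (- (2 * pi * \<i> * of_real b)) * theta (- b) x (\<i> / of_real t)"
        using theta_translate_right[of "- b" x 1] by simp
      then show ?thesis
        using theta_translate_left[of x 1]
        by (simp add: D_def algebra_simps exp_add exp_minus)
    qed
    show "integral {0..1} (\<lambda>x. D x * wave m x) = 0" for m
    proof -
      have "integral {0..1} (\<lambda>x. D x * wave m x) =
          integral {0..1} (\<lambda>x. of_real (sqrt t) * (theta x b (\<i> * of_real t) * wave m x) -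
            exp (2 * pi * \<i> * of_real (b * x)) * theta (- b) x (\<i> / of_real t) * wave m x)"
        by (simp add: D_def algebra_simps)
      also have "\<dots> = of_real (sqrt t) * integral {0..1} (\<lambda>x. theta x b (\<i> * of_real t) * wave m x) -
            integral {0..1} (\<lambda>x. exp (2 * pi * \<i> * of_real (b * x)) * theta (- b) x (\<i> / of_real t) * wave m x)"
        by (subst integral_diff) (auto intro!: integrable_continuous_real continuous_intros)
      also have "\<dots> = 0"
        unfolding theta_fourier_coefficient[OF assms] dual_theta_fourier_coefficient[OF assms]
        using assms by simp
      finally show ?thesis .
    qed
  qed
  then show ?thesis by (simp add: D_def mult.commute)
qed

section \<open>Continuation of the inversion formula to the half plane\<close>

lemma Im_neg_inverse_pos:
  assumes "Im \<tau> > 0"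
  shows "Im (- 1 / \<tau>) > 0"
proof -
  have "Im (- 1 / \<tau>) = Im \<tau> / ((Re \<tau>)\<^sup>2 + (Im \<tau>)\<^sup>2)" by (simp add: Im_divide)
  then show ?thesis using assms by (simp add: add_nonneg_pos)
qed

lemma theta_inversion:
  assumes "Im \<tau> > 0"
  shows "theta a b (- 1 / \<tau>) = csqrt (- \<i> * \<tau>) * exp (2 * pi * \<i> * of_real (a * b)) * theta b (- a) \<tau>"
proof -
  define D where "D \<tau> = theta a b (- 1 / \<tau>) - csqrt (- \<i> * \<tau>) * exp (2 * pi * \<i> * of_real (a * b)) * theta b (- a) \<tau>" for \<tau>
  let ?H = "{\<tau>. Im \<tau> > 0}"
  have "D \<tau> = 0"
  \<comment> \<open>The identity theorem is applied to the ray above \<i> on the imaginary axis,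
    with accumulation point \<i>. The square root is holomorphic because -i\<tau> has positive real
    part.\<close>
  proof (rule analytic_continuation[of D ?H "(\<lambda>s. \<i> * of_real s) ` {1<..}" "\<i>"])
    have "(theta a b \<circ> (\<lambda>\<tau>. - 1 / \<tau>)) holomorphic_on ?H"
      by (rule holomorphic_on_compose_gen[OF _ theta_holomorphic])
         (use Im_neg_inverse_pos in \<open>auto intro!: holomorphic_intros\<close>)
    moreover have "- \<i> * \<tau> \<notin> \<real>\<^sub>\<le>\<^sub>0" if "Im \<tau> > 0" for \<tau>
      using that by (auto simp: complex_nonpos_Reals_iff)
    ultimately show "D holomorphic_on ?H"
      unfolding D_def o_def by (intro holomorphic_intros theta_holomorphic) auto
    show "open ?H" by (rule open_halfspace_Im_gt)
    show "connected ?H" by (intro convex_connected convex_halfspace_Im_gt)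
    show "\<i> islimpt (\<lambda>s. \<i> * of_real s) ` {1<..}"
      unfolding islimpt_approachable
    proof (intro allI impI)
      fix e :: real assume "e > 0"
      then show "\<exists>x'\<in>(\<lambda>s. \<i> * of_real s) ` {1<..}. x' \<noteq> \<i> \<and> dist x' \<i> < e"
        by (intro bexI[of _ "\<i> * of_real (1 + e / 2)"] imageI) (auto simp: dist_norm norm_mult algebra_simps complex_eq_iff)
    qed
    show "D z = 0" if z: "z \<in> (\<lambda>s. \<i> * of_real s) ` {1<..}" for z
    proof -
      obtain s where s: "z = \<i> * of_real s" "s > 1" using z by auto
      \<comment> \<open>The imaginary case is used at \<open>t = 1 / s\<close>, which makes \<i>t
        equal to -1/z and \<i>/t equal to z.\<close>
      have z_eq: "\<i> / of_real (1 / s) = z" "\<i> * of_real (1 / s) = - 1 / z" "- \<i> * z = of_real s"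
        using s by (auto simp: field_simps)
      have "of_real (sqrt (1 / s)) * theta a b (\<i> * of_real (1 / s)) =
          exp (2 * pi * \<i> * of_real (a * b)) * theta (- b) a (\<i> / of_real (1 / s))"
        by (rule theta_inversion_imaginary) (use s in auto)
      then have "of_real (sqrt (1 / s)) * theta a b (- 1 / z) =
          exp (2 * pi * \<i> * of_real (a * b)) * theta b (- a) z"
        unfolding z_eq using theta_minus[of b "- a"] by simp
      moreover have "complex_of_real (sqrt s) * of_real (sqrt (1 / s)) = 1"
        using s by (simp add: real_sqrt_divide)
      moreover have "csqrt (- \<i> * z) = of_real (sqrt s)"
        unfolding z_eq using of_real_sqrt[of s] s by simp
      ultimately show ?thesis
        unfolding D_def by (metis (no_types, opaque_lifting) eq_iff_diff_eq_0 mult.assoc mult_1_left)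
    qed
  qed (use assms in auto)
  then show ?thesis by (simp add: D_def)
qed

subsection \<open>Klein forms\<close>

text \<open>
  The phase is chosen such that only constants independent of \<open>(r, s)\<close> appear under
  \<open>\<tau> \<mapsto> \<tau> + 1\<close> and \<open>\<tau> \<mapsto> -1/\<tau>\<close>.
\<close>

definition klein :: "real \<Rightarrow> real \<Rightarrow> complex \<Rightarrow> complex" where
  "klein r s \<tau> = exp (- (pi * \<i> * of_real (r * (s + 1)))) * theta (1/2 + r) (1/2 + s) \<tau>"

lemma klein_plus_1: "klein r s (\<tau> + 1) = exp (pi * \<i> / 4) * klein r (r + s) \<tau>"
proof -
  \<comment> \<open>The half-integral offsets combine to a full translation by 1, which
    \<open>theta_translate_right\<close> removes.\<close>
  have "1/2 + s + (1/2 + r) + 1/2 = 1/2 + (r + s) + of_int 1" by simp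
  then have "klein r s (\<tau> + 1) = exp (- (pi * \<i> * of_real (r * (s + 1)))) *
      (exp (- (pi * \<i> * (of_real (1/2 + r) * (of_real (1/2 + r) + 1)))) *
      (exp (2 * pi * \<i> * (of_int 1 * of_real (1/2 + r))) * theta (1/2 + r) (1/2 + (r + s)) \<tau>))"
    unfolding klein_def theta_plus_1 by (simp only: theta_translate_right)
  also have "\<dots> = exp (pi * \<i> / 4) * klein r (r + s) \<tau>"
    unfolding klein_def mult.assoc[symmetric] exp_add[symmetric]
    by (intro arg_cong2[of _ _ _ _ "(*)"] arg_cong[of _ _ exp]) (simp_all add: field_simps)
  finally show ?thesis .
qed

lemma exp_pi_i_half: "exp (pi * \<i> / 2) = \<i>"
proof -
  have "pi * \<i> / 2 = \<i> * of_real (pi / 2)" by simp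
  then show ?thesis by (simp only: cis_pi_half flip: cis_conv_exp)
qed

lemma klein_inversion:
  assumes "Im \<tau> > 0"
  shows "klein r s (- 1 / \<tau>) = - \<i> * csqrt (- \<i> * \<tau>) * klein s (- r) \<tau>"
proof -
  \<comment> \<open>Inversion yields the second characteristic -(1/2 + r), which is one less than
    the 1/2 - r that occurs in \<open>klein s (- r)\<close>.\<close>
  have "theta (1/2 + s) (1/2 - r) \<tau> =
      exp (2 * pi * \<i> * (of_int 1 * of_real (1/2 + s))) * theta (1/2 + s) (- (1/2 + r)) \<tau>"
    using theta_translate_right[of "1/2 + s" "- (1/2 + r)" 1 \<tau>] by simp
  then have "theta (1/2 + s) (- (1/2 + r)) \<tau> = exp (- (2 * pi * \<i> * of_real (1/2 + s))) * theta (1/2 + s) (1/2 - r) \<tau>"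
    by (simp add: exp_minus)
  then have "klein r s (- 1 / \<tau>) = csqrt (- \<i> * \<tau>) * (exp (- (pi * \<i> * of_real (r * (s + 1)))) *
      exp (2 * pi * \<i> * of_real ((1/2 + r) * (1/2 + s))) * exp (- (2 * pi * \<i> * of_real (1/2 + s))) *
      theta (1/2 + s) (1/2 - r) \<tau>)"
    unfolding klein_def theta_inversion[OF assms] by simp
  also have "\<dots> = csqrt (- \<i> * \<tau>) * (exp (- (pi * \<i> / 2)) * klein s (- r) \<tau>)"
    unfolding klein_def mult.assoc[symmetric] exp_add[symmetric]
    by (intro arg_cong2[of _ _ _ _ "(*)"] arg_cong[of _ _ exp] refl) (simp_all add: field_simps)
  also have "exp (- (pi * \<i> / 2)) = - \<i>"
    by (simp add: exp_minus exp_pi_i_half)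
  finally show ?thesis by simp
qed

lemma exp_pi_i_cong:
  assumes "x = y + 2 * of_int n"
  shows "exp (pi * \<i> * of_real x) = exp (pi * \<i> * of_real y)"
proof -
  have "exp (pi * \<i> * of_real x) = exp (pi * \<i> * of_real y) * exp (2 * pi * \<i> * of_int n)"
    unfolding assms exp_add[symmetric] by (simp add: algebra_simps)
  then show ?thesis by (simp only: exp_2pi_i_int mult_1_right)
qed

text \<open>Only even translations are considered: the integer left over in the phase is then even,
  so no sign appears besides the bilinear phase.\<close>

lemma klein_translate:
  "klein (r + 2 * of_int k) (s + 2 * of_int l) \<tau> = exp (pi * \<i> * of_real (2 * (of_int l * r - of_int k * s))) * klein r s \<tau>"
proof -
  have "theta (1/2 + (r + 2 * of_int k)) (1/2 + (s + 2 * of_int l)) \<tau> =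
      exp (2 * pi * \<i> * (of_int (2 * l) * of_real (1/2 + r))) * theta (1/2 + r) (1/2 + s) \<tau>"
    using theta_translate_left[of "1/2 + r" "2 * k"] theta_translate_right[of "1/2 + r" "1/2 + s" "2 * l"]
    by (simp add: add.assoc)
  then have "klein (r + 2 * of_int k) (s + 2 * of_int l) \<tau> =
      exp (pi * \<i> * of_real (- ((r + 2 * of_int k) * (s + 2 * of_int l + 1)) + 2 * of_int (2 * l) * (1/2 + r))) *
      theta (1/2 + r) (1/2 + s) \<tau>"
    unfolding klein_def by (simp add: algebra_simps flip: exp_add)
  also have "exp (pi * \<i> * of_real (- ((r + 2 * of_int k) * (s + 2 * of_int l + 1)) + 2 * of_int (2 * l) * (1/2 + r))) =
      exp (pi * \<i> * of_real (2 * (of_int l * r - of_int k * s) - r * (s + 1)))"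
    by (rule exp_pi_i_cong[where n = "l - k - 2 * k * l"]) (simp add: algebra_simps)
  also have "\<dots> * theta (1/2 + r) (1/2 + s) \<tau> = exp (pi * \<i> * of_real (2 * (of_int l * r - of_int k * s))) * klein r s \<tau>"
    unfolding klein_def mult.assoc[symmetric] exp_add[symmetric] by (simp add: algebra_simps)
  finally show ?thesis .
qed

text \<open>Theta itself is even in its characteristics. The sign arises from moving the offsets 1/2
  back by integers, where exp(2 pi i (1/2)) = -1 enters.\<close>

lemma klein_minus: "klein (- r) (- s) \<tau> = - klein r s \<tau>"
proof -
  have "theta (1/2 - r) (1/2 - s) \<tau> = theta (1/2 + r) (s - 1/2) \<tau>"
    using theta_minus[of "1/2 - r" "1/2 - s" \<tau>] theta_translate_left[of "r - 1/2" 1 "s - 1/2" \<tau>]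
    by (simp add: algebra_simps)
  moreover have "theta (1/2 + r) (1/2 + s) \<tau> = exp (2 * pi * \<i> * of_real (1/2 + r)) * theta (1/2 + r) (s - 1/2) \<tau>"
    using theta_translate_right[of "1/2 + r" "s - 1/2" 1 \<tau>] by (simp add: algebra_simps)
  moreover have "exp (2 * pi * \<i> * of_real (1/2 + r)) = - exp (2 * pi * \<i> * of_real r)"
    by (simp add: algebra_simps exp_add)
  ultimately have "theta (1/2 - r) (1/2 - s) \<tau> = - exp (- (2 * pi * \<i> * of_real r)) * theta (1/2 + r) (1/2 + s) \<tau>"
    by (simp add: exp_minus)
  then have "klein (- r) (- s) \<tau> = - (exp (- (pi * \<i> * of_real (- r * (- s + 1)))) * exp (- (2 * pi * \<i> * of_real r)) *
      theta (1/2 + r) (1/2 + s) \<tau>)"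
    unfolding klein_def by simp
  also have "\<dots> = - klein r s \<tau>"
    unfolding klein_def exp_add[symmetric] by (simp add: algebra_simps)
  finally show ?thesis .
qed

text \<open>Pairing removes the branch of the square root: the two factors
  \<open>csqrt (- \<i> * \<tau>)\<close> of the inversion formula multiply to -i\<tau>.\<close>

definition klein_pair :: "real \<Rightarrow> real \<Rightarrow> real \<Rightarrow> real \<Rightarrow> complex \<Rightarrow> complex" where
  "klein_pair r s r' s' \<tau> = klein r s \<tau> * klein r' s' \<tau>"

lemma klein_pair_plus_1: "klein_pair r s r' s' (\<tau> + 1) = \<i> * klein_pair r (r + s) r' (r' + s') \<tau>"
proof -
  have "klein_pair r s r' s' (\<tau> + 1) =
      exp (pi * \<i> / 4) * exp (pi * \<i> / 4) * klein_pair r (r + s) r' (r' + s') \<tau>"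
    unfolding klein_pair_def klein_plus_1 by (simp only: mult_ac)
  also have "exp (pi * \<i> / 4) * exp (pi * \<i> / 4) = exp (pi * \<i> / 2)"
    unfolding exp_add[symmetric] by (simp add: mult.commute)
  finally show ?thesis by (simp only: exp_pi_i_half)
qed

lemma klein_pair_inversion:
  assumes "Im \<tau> > 0"
  shows "klein_pair r s r' s' (- 1 / \<tau>) = \<i> * \<tau> * klein_pair s (- r) s' (- r') \<tau>"
proof -
  have "klein_pair r s r' s' (- 1 / \<tau>) = - ((csqrt (- \<i> * \<tau>))\<^sup>2) * klein_pair s (- r) s' (- r') \<tau>"
    unfolding klein_pair_def klein_inversion[OF assms] by (simp add: power2_eq_square mult_ac del: power2_csqrt)
  then show ?thesis by simp
qed

text \<open>The translations are assumptions in the form of equations, so that the rule applies to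
  characteristics of any syntactic shape and leaves arithmetic goals.\<close>

lemma klein_pair_translate:
  assumes "r1 = r + 2 * of_int k" "s1 = s + 2 * of_int l" "r1' = r' + 2 * of_int k'" "s1' = s' + 2 * of_int l'"
    and "x = 2 * (of_int l * r - of_int k * s + of_int l' * r' - of_int k' * s')"
  shows "klein_pair r1 s1 r1' s1' \<tau> = exp (pi * \<i> * of_real x) * klein_pair r s r' s' \<tau>"
  unfolding assms klein_pair_def klein_translate
  by (simp add: algebra_simps exp_add exp_diff)

subsection \<open>The multiplier of the sixth power of eta\<close>

text \<open>Closure under right multiplication by T and S suffices, by the Euclidean algorithm on
  the bottom row. Inverses come from S^2 = -I.\<close>

lemma SL2Z_induct:
  fixes P :: "int \<Rightarrow> int \<Rightarrow> int \<Rightarrow> int \<Rightarrow> bool"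
  assumes det: "a * d - b * c = 1"
    and one: "P 1 0 0 1"
    and T: "\<And>a b c d. a * d - b * c = 1 \<Longrightarrow> P a b c d \<Longrightarrow> P a (a + b) c (c + d)"
    and S: "\<And>a b c d. a * d - b * c = 1 \<Longrightarrow> P a b c d \<Longrightarrow> P b (- a) d (- c)"
  shows "P a b c d"
proof -
  have neg: "P (- a) (- b) (- c) (- d)" if "a * d - b * c = 1" "P a b c d" for a b c d
    using S[OF _ S[OF that]] that by (simp add: algebra_simps)
  have S_inv: "P a b c d" if "a * d - b * c = 1" "P b (- a) d (- c)" for a b c d
    using neg[OF _ S[OF _ that(2)]] that by (simp add: algebra_simps)
  have T_inv: "P a (b - a) c (d - c)" if det: "a * d - b * c = 1" and "P a b c d" for a b c d
  proof -
    \<comment> \<open>\<open>T\<inverse>\<close> is \<open>STSTS\<close> up to sign\<close>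
    have "P b (b - a) d (d - c)" using T[OF _ S[OF that]] det by (simp add: algebra_simps)
    then have "P (b - a) (- a) (d - c) (- c)"
      using T[OF _ S[of b "d - c" "b - a" d]] det by (simp add: algebra_simps)
    then show ?thesis
      using neg[OF _ S[of "b - a" "- c" "- a" "d - c"]] det by (simp add: algebra_simps)
  qed
  have T_pow: "P a (b + n * a) c (d + n * c)" if det: "a * d - b * c = 1" and "P a b c d" for a b c d n
  proof (induction n rule: int_induct[where k = 0])
    case base
    then show ?case using that by simp
  next
    case (step1 i)
    then show ?case using T[of a "d + i * c" "b + i * a" c] det by (simp add: algebra_simps)
  next
    case (step2 i)
    then show ?case using T_inv[of a "d + i * c" "b + i * a" c] det by (simp add: algebra_simps)
  qed
  show ?thesis using det
  proof (induction "nat \<bar>c\<bar>" arbitrary: a b c d rule: less_induct)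
    case less
    show ?case
    proof (cases "c = 0")
      case True
      then have "a = 1 \<and> d = 1 \<or> a = - 1 \<and> d = - 1"
        using less.prems zmult_eq_1_iff by auto
      then show ?thesis
      proof
        assume "a = 1 \<and> d = 1"
        then show ?thesis using T_pow[of 1 1 0 0 b] one True by simp
      next
        assume "a = - 1 \<and> d = - 1"
        then show ?thesis using neg[OF _ T_pow[of 1 1 0 0 "- b"]] one True by simp
      qed
    next
      case False
      \<comment> \<open>Multiplying by T^(-q) turns d into d mod c, and S moves this remainder into
        the lower left corner, where it is smaller than |c|.\<close>
      define q where "q = d div c"
      have r: "d - q * c = d mod c" by (simp add: q_def minus_div_mult_eq_mod)
      have det: "a * (d - q * c) - (b - q * a) * c = 1" using less.prems by (simp add: algebra_simps)
      have "P (b - q * a) (- a) (d - q * c) (- c)"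
      proof (rule less.hyps)
        show "nat \<bar>d - q * c\<bar> < nat \<bar>c\<bar>" unfolding r using False by (simp add: abs_mod_less)
      qed (use less.prems in \<open>simp add: algebra_simps\<close>)
      then have "P a (b - q * a) c (d - q * c)" by (rule S_inv[OF det])
      then show ?thesis using T_pow[OF det, of q] by simp
    qed
  qed
qed

text \<open>This is the exponent of \<open>nu_eta\<close> in units of pi i/12. After the sixth power
  the unit is pi i/2, so it matters only modulo 4.\<close>

definition eta6_exponent :: "int \<Rightarrow> int \<Rightarrow> int \<Rightarrow> int \<Rightarrow> int" where
  "eta6_exponent a b c d =
     (if odd c then (a + d) * c - b * d * (c\<^sup>2 - 1) - 3 * c
      else (a + d) * c - b * d * (c\<^sup>2 - 1) + 3 * d - 3 - 3 * c * d)"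

lemma eta6_exponent_cong:
  assumes "[a = a'] (mod 4)" "[b = b'] (mod 4)" "[c = c'] (mod 4)" "[d = d'] (mod 4)"
  shows "[eta6_exponent a b c d = eta6_exponent a' b' c' d'] (mod 4)"
proof -
  have "even c \<longleftrightarrow> even c'"
    using assms(3) unfolding cong_def by presburger
  moreover have "[3 * d = 3 * d'] (mod 4)" "[3 * c * d = 3 * c' * d'] (mod 4)" "[3 * c = 3 * c'] (mod 4)"
    using assms by (auto intro!: cong_mult)
  ultimately show ?thesis
    unfolding eta6_exponent_def using assms
    by (auto intro!: cong_add cong_diff cong_mult cong_pow)
qed

text \<open>A finite check over the matrices of determinant 1 modulo 4, to which
  \<open>eta6_exponent_cong\<close> reduces the general case.\<close>

lemma eta6_exponent_generators_residues:
  "\<forall>a\<in>set [0..3]. \<forall>b\<in>set [0..3]. \<forall>c\<in>set [0..3]. \<forall>d\<in>set [0..3]. (a * d - b * c) mod 4 = 1 \<longrightarrow>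
     eta6_exponent a (a + b) c (c + d) mod 4 = (eta6_exponent a b c d + 1) mod 4 \<and>
     eta6_exponent b (- a) d (- c) mod 4 = (eta6_exponent a b c d + 1) mod 4"
  by code_simp

lemma eta6_exponent_generators:
  assumes "a * d - b * c = 1"
  shows "[eta6_exponent a (a + b) c (c + d) = eta6_exponent a b c d + 1] (mod 4)" (is ?T)
    and "[eta6_exponent b (- a) d (- c) = eta6_exponent a b c d + 1] (mod 4)" (is ?S)
proof -
  define a' b' c' d' where defs: "a' = a mod 4" "b' = b mod 4" "c' = c mod 4" "d' = d mod 4"
  have cong: "[a = a'] (mod 4)" "[b = b'] (mod 4)" "[c = c'] (mod 4)" "[d = d'] (mod 4)"
    by (auto simp: defs cong_def)
  have "[a * d - b * c = a' * d' - b' * c'] (mod 4)"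
    by (intro cong_diff cong_mult cong)
  then have "(a' * d' - b' * c') mod 4 = 1" using assms by (simp add: cong_def)
  moreover have "a' \<in> set [0..3]" "b' \<in> set [0..3]" "c' \<in> set [0..3]" "d' \<in> set [0..3]"
    unfolding defs set_upto by (auto intro: order_less_imp_le simp flip: zle_diff1_eq)
  ultimately have "[eta6_exponent a' (a' + b') c' (c' + d') = eta6_exponent a' b' c' d' + 1] (mod 4)"
      "[eta6_exponent b' (- a') d' (- c') = eta6_exponent a' b' c' d' + 1] (mod 4)"
    using eta6_exponent_generators_residues unfolding cong_def by blast+
  moreover have "[eta6_exponent a b c d + 1 = eta6_exponent a' b' c' d' + 1] (mod 4)"
    by (intro cong_add eta6_exponent_cong cong cong_refl)
  moreover have "[eta6_exponent a (a + b) c (c + d) = eta6_exponent a' (a' + b') c' (c' + d')] (mod 4)"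
    by (intro eta6_exponent_cong cong cong_add)
  moreover have "[eta6_exponent b (- a) d (- c) = eta6_exponent b' (- a') d' (- c')] (mod 4)"
    by (intro eta6_exponent_cong cong) (use cong in \<open>auto simp: cong_minus_minus_iff\<close>)
  ultimately show ?T ?S by (meson cong_sym cong_trans)+
qed

definition eta6_mult :: "int \<Rightarrow> int \<Rightarrow> int \<Rightarrow> int \<Rightarrow> complex" where
  "eta6_mult a b c d = exp (pi * \<i> / 2 * of_int (eta6_exponent a b c d))"

lemma exp_pi_i_half_cong:
  assumes "[m = n + 1] (mod 4)"
  shows "exp (pi * \<i> / 2 * of_int m) = \<i> * exp (pi * \<i> / 2 * of_int n)"
proof -
  obtain k where "m = n + 1 + 4 * k"
    using cong_sym[OF assms] by (auto simp: cong_iff_lin)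
  then have "exp (pi * \<i> / 2 * of_int m) = exp (pi * \<i> / 2) * exp (pi * \<i> / 2 * of_int n) * exp (2 * pi * \<i> * of_int k)"
    unfolding exp_add[symmetric] by (simp add: algebra_simps)
  then show ?thesis by (simp only: exp_2pi_i_int mult_1_right exp_pi_i_half)
qed

text \<open>These factors \<i> match those in \<open>klein_pair_plus_1\<close> and
  \<open>klein_pair_inversion\<close>.\<close>

lemma eta6_mult_generators:
  assumes "a * d - b * c = 1"
  shows "eta6_mult a (a + b) c (c + d) = \<i> * eta6_mult a b c d"
    and "eta6_mult b (- a) d (- c) = \<i> * eta6_mult a b c d"
  unfolding eta6_mult_def by (intro exp_pi_i_half_cong eta6_exponent_generators assms)+

lemma jacobi_square:
  assumes "coprime a n"
  shows "(jacobi a n)\<^sup>2 = 1"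
proof -
  have "(Legendre a p ^ k)\<^sup>2 = 1" if "p \<in> prime_factors n" for p k
  proof -
    have "\<not> p dvd a"
      using that assms by (metis coprime_common_divisor in_prime_factors_imp_dvd in_prime_factors_imp_prime not_prime_unit)
    then have "(Legendre a p)\<^sup>2 = 1"
      by (simp add: Legendre_def cong_0_iff)
    then show ?thesis by (metis power_mult mult.commute power_one)
  qed
  then show ?thesis
    unfolding jacobi_def prod_power_distrib by (intro prod.neutral) simp
qed

text \<open>Coprimality of \<open>c\<close> and \<open>d\<close> makes the Jacobi symbols
  \<plusminus>1, so they vanish in the even power.\<close>

lemma nu_eta_power_6:
  assumes "a * d - b * c = 1"
  shows "nu_eta a b c d ^ 6 = eta6_mult a b c d"
proof -
  have "coprime c d"
  proof (rule coprimeI)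
    fix x assume "x dvd c" "x dvd d"
    then have "x dvd a * d - b * c" by simp
    then show "is_unit x" using assms by simp
  qed
  then have "(jacobi d \<bar>c\<bar>)\<^sup>2 = 1" "(jacobi c \<bar>d\<bar>)\<^sup>2 = 1"
    by (auto intro!: jacobi_square simp: coprime_commute)
  then have "(jacobi_upper d c)\<^sup>2 = 1" "(jacobi_lower c d)\<^sup>2 = 1"
    by (auto simp: jacobi_upper_def jacobi_lower_def)
  moreover have "complex_of_int m ^ 6 = 1" if "m\<^sup>2 = 1" for m
  proof -
    have "m ^ 6 = (m\<^sup>2) ^ 3" by (simp flip: power_mult)
    then have "of_int (m ^ 6) = (1 :: complex)" using that by simp
    then show ?thesis by simp
  qed
  ultimately have J: "complex_of_int (jacobi_upper d c) ^ 6 = 1" "complex_of_int (jacobi_lower c d) ^ 6 = 1"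
    by blast+
  have exp_6: "exp (pi * \<i> / 12 * of_int m) ^ 6 = exp (pi * \<i> / 2 * of_int m)" for m
    by (simp add: field_simps flip: exp_of_nat_mult)
  show ?thesis
    unfolding nu_eta_def eta6_mult_def eta6_exponent_def
    by (cases "even c")
       (simp_all only: power_mult_distrib J exp_6 mult_1_left if_True if_False not_True_eq_False not_False_eq_True)
qed

subsection \<open>Transformation formulas\<close>

text \<open>Induction over words in T and S. A generator on the right replaces \<tau> by \<tau> + 1
  or -1/\<tau>, hence the claim is quantified over \<tau> while the two vectors stay fixed.\<close>

lemma klein_pair_moebius:
  assumes "a * d - b * c = 1" "Im \<tau> > 0"
  shows "klein_pair r s r' s' (moebius a b c d \<tau>) = eta6_mult a b c d * (of_int c * \<tau> + of_int d) *
    klein_pair (of_int a * r + of_int c * s) (of_int b * r + of_int d * s)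
      (of_int a * r' + of_int c * s') (of_int b * r' + of_int d * s') \<tau>"
proof -
  let ?P = "\<lambda>a b c d. \<forall>\<tau>. Im \<tau> > 0 \<longrightarrow>
    klein_pair r s r' s' (moebius a b c d \<tau>) = eta6_mult a b c d * (of_int c * \<tau> + of_int d) *
    klein_pair (of_int a * r + of_int c * s) (of_int b * r + of_int d * s)
      (of_int a * r' + of_int c * s') (of_int b * r' + of_int d * s') \<tau>"
  have "?P a b c d"
  proof (rule SL2Z_induct[OF assms(1)], goal_cases)
    case 1
    show ?case by (simp add: moebius_def eta6_mult_def eta6_exponent_def)
  next
    case (2 a b c d)
    show ?case
    proof (intro allI impI)
      fix \<tau> assume \<tau>: "Im \<tau> > 0"
      have "moebius a (a + b) c (c + d) \<tau> = moebius a b c d (\<tau> + 1)"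
        by (simp add: moebius_def algebra_simps)
      moreover have "klein_pair r s r' s' (moebius a b c d (\<tau> + 1)) =
          eta6_mult a b c d * (of_int c * (\<tau> + 1) + of_int d) *
          klein_pair (of_int a * r + of_int c * s) (of_int b * r + of_int d * s)
            (of_int a * r' + of_int c * s') (of_int b * r' + of_int d * s') (\<tau> + 1)"
        using 2(2) \<tau> by simp
      ultimately show "klein_pair r s r' s' (moebius a (a + b) c (c + d) \<tau>) =
          eta6_mult a (a + b) c (c + d) * (of_int c * \<tau> + of_int (c + d)) *
          klein_pair (of_int a * r + of_int c * s) (of_int (a + b) * r + of_int (c + d) * s)
            (of_int a * r' + of_int c * s') (of_int (a + b) * r' + of_int (c + d) * s') \<tau>"
        by (simp only: klein_pair_plus_1 eta6_mult_generators[OF 2(1)]) (simp add: algebra_simps)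
    qed
  next
    case (3 a b c d)
    show ?case
    proof (intro allI impI)
      fix \<tau> assume \<tau>: "Im \<tau> > 0"
      then have "\<tau> \<noteq> 0" by auto
      \<comment> \<open>The common factor \<tau> cancels in the quotient; in the automorphy factor
        it is supplied by \<open>klein_pair_inversion\<close>.\<close>
      have num: "of_int b * \<tau> + of_int (- a) = \<tau> * (of_int a * (- 1 / \<tau>) + of_int b)"
        and den: "of_int d * \<tau> + of_int (- c) = \<tau> * (of_int c * (- 1 / \<tau>) + of_int d)"
        using \<open>\<tau> \<noteq> 0\<close> by (simp_all add: field_simps)
      have "moebius b (- a) d (- c) \<tau> = moebius a b c d (- 1 / \<tau>)"
        unfolding moebius_def num den using \<open>\<tau> \<noteq> 0\<close> by simp
      moreover have "Im (- 1 / \<tau>) > 0" by (rule Im_neg_inverse_pos[OF \<tau>])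
      ultimately have "klein_pair r s r' s' (moebius b (- a) d (- c) \<tau>) =
          eta6_mult a b c d * (of_int c * (- 1 / \<tau>) + of_int d) *
          klein_pair (of_int a * r + of_int c * s) (of_int b * r + of_int d * s)
            (of_int a * r' + of_int c * s') (of_int b * r' + of_int d * s') (- 1 / \<tau>)"
        using 3(2) by simp
      then show "klein_pair r s r' s' (moebius b (- a) d (- c) \<tau>) =
          eta6_mult b (- a) d (- c) * (of_int d * \<tau> + of_int (- c)) *
          klein_pair (of_int b * r + of_int d * s) (of_int (- a) * r + of_int (- c) * s)
            (of_int b * r' + of_int d * s') (of_int (- a) * r' + of_int (- c) * s') \<tau>"
        unfolding den klein_pair_inversion[OF \<tau>] eta6_mult_generators[OF 3(1)]
        by (simp add: mult_ac)
    qed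
  qed
  then show ?thesis using assms(2) by blast
qed

section \<open>The function P and the group modulo 5\<close>

lemma P_theta_eq_klein_pair:
  "P_theta \<tau> = exp (- (4 * pi * \<i> / 5)) * klein_pair (- 2/5) (- 2/5) (- 2/5) (2/5) \<tau>"
proof -
  \<comment> \<open>The halved characteristics 1/10 and 9/10 are 1/2 - 2/5 and 1/2 + 2/5. The two
    Klein phases contribute 6/25 + 14/25 = 4/5.\<close>
  have "klein_pair (- 2/5) (- 2/5) (- 2/5) (2/5) \<tau> = exp (4 * pi * \<i> / 5) * P_theta \<tau>"
    unfolding klein_pair_def klein_def P_theta_def theta_char_eq_theta
    by (simp add: exp_add[symmetric] field_simps)
  then show ?thesis by (simp add: exp_minus)
qed

lemma exp_pi_i_add: "exp (pi * \<i> * of_real x) * exp (pi * \<i> * of_real y) = exp (pi * \<i> * of_real (x + y))"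
  by (simp add: distrib_left exp_add)

lemma klein_pair_minus: "klein_pair (- r) (- s) (- r') (- s') \<tau> = klein_pair r s r' s' \<tau>"
  by (simp add: klein_pair_def klein_minus)

text \<open>Changing a matrix entry by a multiple of 5 moves the vectors by even integers, since
  (2/5) * 5 = 2. \<open>klein_pair_translate\<close> then gives a phase, which is compared with
  \<open>E_exp a b c d / 5\<close> modulo 2; in each case the witness \<open>n\<close> is half the
  difference.\<close>

lemma klein_pair_transform_mod_5:
  assumes "Gamma_theta5 a b c d"
  shows "klein_pair (- 2/5 * of_int (a + c)) (- 2/5 * of_int (b + d)) (- 2/5 * of_int (a - c)) (- 2/5 * of_int (b - d)) \<tau> =
    exp (pi * \<i> * of_real (E_exp a b c d / 5)) * klein_pair (- 2/5) (- 2/5) (- 2/5) (2/5) \<tau>"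
    (is "?L = _ * ?K")
proof -
  have diff: "x = y + 5 * ((x - y) div 5)" if "[x = y] (mod 5)" for x y :: int
    using that by (simp add: cong_iff_dvd_diff)
  consider (I) "cong_mat5 a b c d 1 0 0 1" | (mI) "cong_mat5 a b c d (-1) 0 0 (-1)"
    | (S) "cong_mat5 a b c d 0 (-1) 1 0" | (mS) "cong_mat5 a b c d 0 1 (-1) 0"
    using assms unfolding Gamma_theta5_def by blast
  then show ?thesis
  proof cases
    case I
    then obtain m n p q where [simp]: "a = 1 + 5 * m" "b = 5 * n" "c = 5 * p" "d = 1 + 5 * q"
      unfolding cong_mat5_def by (metis diff add_0)
    have "?L = exp (pi * \<i> * of_real (8/5 * (of_int n - of_int p))) * ?K"
      by (rule klein_pair_translate[where r = "- 2/5" and s = "- 2/5" and r' = "- 2/5" and s' = "2/5"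
            and k = "- (m + p)" and l = "- (n + q)" and k' = "- (m - p)" and l' = "- (n - q)"])
         (simp_all add: field_simps)
    also have "exp (pi * \<i> * of_real (8/5 * (of_int n - of_int p))) = exp (pi * \<i> * of_real (E_exp a b c d / 5))"
      using I by (intro exp_pi_i_cong[where n = "2 * n + 4 * m * n + 4 * p * q"]) (simp add: E_exp_def field_simps)
    finally show ?thesis .
  next
    case mI
    then obtain m n p q where [simp]: "a = - 1 + 5 * m" "b = 5 * n" "c = 5 * p" "d = - 1 + 5 * q"
      unfolding cong_mat5_def by (metis diff add_0)
    have E: "E_exp a b c d = - 6 * b / 5 - 8 * a * b / 5 - 8 * c * d / 5"
      using mI by (simp add: E_exp_def cong_mat5_def cong_def)
    have "?L = exp (pi * \<i> * of_real (8/5 * (of_int p - of_int n))) * klein_pair (2/5) (2/5) (2/5) (- 2/5) \<tau>"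
      by (rule klein_pair_translate[where r = "2/5" and s = "2/5" and r' = "2/5" and s' = "- 2/5"
            and k = "- (m + p)" and l = "- (n + q)" and k' = "- (m - p)" and l' = "- (n - q)"])
         (simp_all add: field_simps)
    \<comment> \<open>Only E modulo 10 matters, and -6b/5 differs from 4b/5 by 2b = 10n; this is the
      sign-reversed counterpart of the -4b/5 in the first case.\<close>
    also have "exp (pi * \<i> * of_real (8/5 * (of_int p - of_int n))) = exp (pi * \<i> * of_real (E_exp a b c d / 5))"
      unfolding E by (intro exp_pi_i_cong[where n = "- n + 4 * m * n + 4 * p * q"]) (simp add: field_simps)
    also have "klein_pair (2/5) (2/5) (2/5) (- 2/5) \<tau> = ?K"
      using klein_pair_minus[of "2/5" "2/5" "2/5" "- 2/5"] by simp
    finally show ?thesis .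
  next
    case S
    then obtain m n p q where [simp]: "a = 5 * m" "b = - 1 + 5 * n" "c = 1 + 5 * p" "d = 5 * q"
      unfolding cong_mat5_def by (metis diff add_0)
    have E: "E_exp a b c d = - 5 - 4 * d / 5 - 8 * a * b / 5 - 8 * c * d / 5"
      using S by (simp add: E_exp_def cong_mat5_def cong_def)
    have "?L = exp (pi * \<i> * of_real (8/5 * (of_int m + of_int q))) * klein_pair (- 2/5) (2/5) (2/5) (2/5) \<tau>"
      by (rule klein_pair_translate[where r = "- 2/5" and s = "2/5" and r' = "2/5" and s' = "2/5"
            and k = "- (m + p)" and l = "- (n + q)" and k' = "- (m - p)" and l' = "- (n - q)"])
         (simp_all add: field_simps)
    \<comment> \<open>S exchanges the two vectors and negates one of them. The single sign, written
      as exp(-pi i), accounts for the -5 in E.\<close>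
    also have "klein_pair (- 2/5) (2/5) (2/5) (2/5) \<tau> = exp (pi * \<i> * of_real (- 1)) * ?K"
      using klein_minus[of "2/5" "2/5" \<tau>] by (simp add: klein_pair_def exp_minus)
    also have "exp (pi * \<i> * of_real (8/5 * (of_int m + of_int q))) * (exp (pi * \<i> * of_real (- 1)) * ?K) =
        exp (pi * \<i> * of_real (8/5 * (of_int m + of_int q) + - 1)) * ?K"
      by (simp only: exp_pi_i_add flip: mult.assoc)
    also have "exp (pi * \<i> * of_real (8/5 * (of_int m + of_int q) + - 1)) = exp (pi * \<i> * of_real (E_exp a b c d / 5))"
      unfolding E by (intro exp_pi_i_cong[where n = "2 * q + 4 * m * n + 4 * p * q"]) (simp add: field_simps)
    finally show ?thesis .
  next
    case mS
    then obtain m n p q where [simp]: "a = 5 * m" "b = 1 + 5 * n" "c = - 1 + 5 * p" "d = 5 * q"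
      unfolding cong_mat5_def by (metis diff add_0)
    have E: "E_exp a b c d = - 5 + 4 * d / 5 - 8 * a * b / 5 - 8 * c * d / 5"
      using mS by (simp add: E_exp_def cong_mat5_def cong_def)
    have "?L = exp (pi * \<i> * of_real (- 8/5 * (of_int m + of_int q))) * klein_pair (2/5) (- 2/5) (- 2/5) (- 2/5) \<tau>"
      by (rule klein_pair_translate[where r = "2/5" and s = "- 2/5" and r' = "- 2/5" and s' = "- 2/5"
            and k = "- (m + p)" and l = "- (n + q)" and k' = "- (m - p)" and l' = "- (n - q)"])
         (simp_all add: field_simps)
    also have "klein_pair (2/5) (- 2/5) (- 2/5) (- 2/5) \<tau> = exp (pi * \<i> * of_real (- 1)) * ?K"
      using klein_minus[of "2/5" "- 2/5" \<tau>] by (simp add: klein_pair_def exp_minus)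
    also have "exp (pi * \<i> * of_real (- 8/5 * (of_int m + of_int q))) * (exp (pi * \<i> * of_real (- 1)) * ?K) =
        exp (pi * \<i> * of_real (- 8/5 * (of_int m + of_int q) + - 1)) * ?K"
      by (simp only: exp_pi_i_add flip: mult.assoc)
    also have "exp (pi * \<i> * of_real (- 8/5 * (of_int m + of_int q) + - 1)) = exp (pi * \<i> * of_real (E_exp a b c d / 5))"
      unfolding E by (intro exp_pi_i_cong[where n = "- 2 * q + 4 * m * n + 4 * p * q"]) (simp add: field_simps)
    finally show ?thesis .
  qed
qed

theorem mainTheorem3:
  fixes a b c d :: int and \<tau> :: complex
  assumes "Gamma_theta5 a b c d"
    and "Im \<tau> > 0"
  shows "P_theta (moebius a b c d \<tau>) =
           nu_P a b c d * (of_int c * \<tau> + of_int d) * P_theta \<tau>"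
proof -
  have det: "a * d - b * c = 1" using assms(1) by (simp add: Gamma_theta5_def)
  \<comment> \<open>These are the coordinates of the two vectors multiplied by M from the
    right.\<close>
  have args: "of_int x * (- 2/5) + of_int y * (- 2/5) = (- 2/5 * of_int (x + y) :: real)"
      "of_int x * (- 2/5) + of_int y * (2/5) = (- 2/5 * of_int (x - y) :: real)" for x y
    by (simp_all add: field_simps)
  have "klein_pair (- 2/5) (- 2/5) (- 2/5) (2/5) (moebius a b c d \<tau>) =
      eta6_mult a b c d * (of_int c * \<tau> + of_int d) * klein_pair (- 2/5 * of_int (a + c)) (- 2/5 * of_int (b + d))
        (- 2/5 * of_int (a - c)) (- 2/5 * of_int (b - d)) \<tau>"
    unfolding klein_pair_moebius[OF det assms(2)] args by (rule refl)
  then show ?thesis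
    unfolding P_theta_eq_klein_pair klein_pair_transform_mod_5[OF assms(1)] nu_P_def nu_eta_power_6[OF det]
    by (simp add: mult_ac)
qed

end
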